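(* Let $G$ be a finitely generated group and let $H\le L\le G$, with $H$ and $L$ finitely generated. Suppose that $H$ is stable in $G$. Then $H$ is stable in $L$.
   Context: For $\kappa\ge 1$, $\lambda\ge 0$, a $(\kappa,\lambda)$-quasi-isometric embedding $\phi\colon X\to Y$ is a map with $\frac1\kappa d_X(a,b)-\lambda\le d_Y(\phi(a),\phi(b))\le \kappa d_X(a,b)+\lambda$ for all $a,b\in X$. A $\kappa$-quasigeodesic in $Y$ is a $(\kappa,\kappa)$-quasi-isometric embedding of an interval into $Y$. A finitely generated subgroup $H$ of a finitely generated group $G$ is stable in $G$ if (a) the inclusion $H\to G$ is a quasi-isometric embedding for word metrics, and (b) for any $\kappa>1$ there exists $D>0$ such that any two $\kappa$-quasigeodesics in $G$ (in a Cayley graph with respect to a finite generating set) with the same endpoints $a,b\in H$ are $D$-Hausdorff close, i.e. each is contained in the $D$-neighborhood of the other. This is independent of the finite generating sets. *)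

theory Defs
  imports "HOL-Algebra.Generated_Groups" "HOL-Analysis.Analysis"
begin

text \<open>Metric spaces are given by a carrier and a distance function, as in the
  library locale \<^locale>\<open>Metric_space\<close>.\<close>

definition qi_embedding ::
  "real \<Rightarrow> real \<Rightarrow> 'x set \<Rightarrow> ('x \<Rightarrow> 'x \<Rightarrow> real) \<Rightarrow> 'y set \<Rightarrow> ('y \<Rightarrow> 'y \<Rightarrow> real) \<Rightarrow> ('x \<Rightarrow> 'y) \<Rightarrow> bool" where
  "qi_embedding \<kappa> c X dX Y dY \<phi> \<longleftrightarrow>
     1 \<le> \<kappa> \<and> 0 \<le> c \<and> \<phi> \<in> X \<rightarrow> Y \<and>
     (\<forall>a\<in>X. \<forall>b\<in>X. 1 / \<kappa> * dX a b - c \<le> dY (\<phi> a) (\<phi> b) \<and> dY (\<phi> a) (\<phi> b) \<le> \<kappa> * dX a b + c)"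

definition quasigeodesic ::
  "real \<Rightarrow> real set \<Rightarrow> 'y set \<Rightarrow> ('y \<Rightarrow> 'y \<Rightarrow> real) \<Rightarrow> (real \<Rightarrow> 'y) \<Rightarrow> bool" where
  "quasigeodesic \<kappa> I Y dY \<gamma> \<longleftrightarrow> is_interval I \<and> qi_embedding \<kappa> \<kappa> I dist Y dY \<gamma>"

definition quasigeodesic_between ::
  "real \<Rightarrow> real \<Rightarrow> real \<Rightarrow> 'y set \<Rightarrow> ('y \<Rightarrow> 'y \<Rightarrow> real) \<Rightarrow> (real \<Rightarrow> 'y) \<Rightarrow> 'y \<Rightarrow> 'y \<Rightarrow> bool" where
  "quasigeodesic_between \<kappa> s t Y dY \<gamma> a b \<longleftrightarrow>
     s \<le> t \<and> quasigeodesic \<kappa> {s..t} Y dY \<gamma> \<and> \<gamma> s = a \<and> \<gamma> t = b"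

definition in_nbhd :: "('y \<Rightarrow> 'y \<Rightarrow> real) \<Rightarrow> real \<Rightarrow> 'y set \<Rightarrow> 'y set \<Rightarrow> bool" where
  "in_nbhd d D A B \<longleftrightarrow> (\<forall>x\<in>A. \<exists>y\<in>B. d x y \<le> D)"

definition hausdorff_close :: "('y \<Rightarrow> 'y \<Rightarrow> real) \<Rightarrow> real \<Rightarrow> 'y set \<Rightarrow> 'y set \<Rightarrow> bool" where
  "hausdorff_close d D A B \<longleftrightarrow> in_nbhd d D A B \<and> in_nbhd d D B A"

definition finite_generating_set :: "('a, 'b) monoid_scheme \<Rightarrow> 'a set \<Rightarrow> bool" where
  "finite_generating_set G S \<longleftrightarrow> finite S \<and> S \<subseteq> carrier G \<and> generate G S = carrier G"

definition finitely_generated :: "('a, 'b) monoid_scheme \<Rightarrow> bool" where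
  "finitely_generated G \<longleftrightarrow> (\<exists>S. finite_generating_set G S)"

definition word_length :: "('a, 'b) monoid_scheme \<Rightarrow> 'a set \<Rightarrow> 'a \<Rightarrow> nat" where
  "word_length G S g =
     (LEAST n. \<exists>ws. length ws = n \<and> set ws \<subseteq> S \<union> m_inv G ` S \<and> foldr (\<otimes>\<^bsub>G\<^esub>) ws \<one>\<^bsub>G\<^esub> = g)"

definition word_dist :: "('a, 'b) monoid_scheme \<Rightarrow> 'a set \<Rightarrow> 'a \<Rightarrow> 'a \<Rightarrow> real" where
  "word_dist G S g h = real (word_length G S (inv\<^bsub>G\<^esub> g \<otimes>\<^bsub>G\<^esub> h))"

text \<open>The Cayley graph is the simple graph on \<^term>\<open>carrier G\<close> with an edge between distinct
  \<open>g\<close> and \<open>g s\<close> for each generator \<open>s\<close>; we use its geometric realization, in which every edge is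
  an interval of length 1. A point is encoded by its barycentric coordinates, a function on the
  vertices supported on one vertex or on the two ends of an edge.\<close>

definition cayley_adj :: "('a, 'b) monoid_scheme \<Rightarrow> 'a set \<Rightarrow> 'a \<Rightarrow> 'a \<Rightarrow> bool" where
  "cayley_adj G S u v \<longleftrightarrow> u \<in> carrier G \<and> v \<in> carrier G \<and> u \<noteq> v \<and>
     (\<exists>s\<in>S. v = u \<otimes>\<^bsub>G\<^esub> s \<or> u = v \<otimes>\<^bsub>G\<^esub> s)"

definition vertex :: "'a \<Rightarrow> 'a \<Rightarrow> real" where
  "vertex u = (\<lambda>x. if x = u then 1 else 0)"

definition cayley_graph :: "('a, 'b) monoid_scheme \<Rightarrow> 'a set \<Rightarrow> ('a \<Rightarrow> real) set" where
  "cayley_graph G S =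
     vertex ` carrier G \<union>
     {(\<lambda>x. (1 - t) * vertex u x + t * vertex v x) | t u v. t \<in> {0..1} \<and> cayley_adj G S u v}"

definition supp :: "('a \<Rightarrow> real) \<Rightarrow> 'a set" where
  "supp p = {x. p x \<noteq> 0}"

text \<open>The path metric. Points of a common closed edge are joined by a segment of that edge, whose
  length is half the \<open>l\<^sup>1\<close>-distance of the coordinates. Otherwise a shortest path leaves
  \<open>p\<close> through an end \<open>u\<close> of its edge, at distance \<^term>\<open>1 - p u\<close>, and enters the edge of \<open>q\<close>
  through an end \<open>v\<close>; between vertices the path metric is the word metric.\<close>

definition cayley_dist :: "('a, 'b) monoid_scheme \<Rightarrow> 'a set \<Rightarrow> ('a \<Rightarrow> real) \<Rightarrow> ('a \<Rightarrow> real) \<Rightarrow> real" where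
  "cayley_dist G S p q =
     (if \<exists>u v. cayley_adj G S u v \<and> supp p \<union> supp q \<subseteq> {u, v}
      then (\<Sum>x\<in>supp p \<union> supp q. \<bar>p x - q x\<bar>) / 2
      else Min {(1 - p u) + word_dist G S u v + (1 - q v) | u v. u \<in> supp p \<and> v \<in> supp q})"

text \<open>The notion does not depend on the finite generating sets, so they are quantified
  existentially.\<close>

definition stable :: "('a, 'b) monoid_scheme \<Rightarrow> 'a set \<Rightarrow> bool" where
  "stable G H \<longleftrightarrow> group G \<and> subgroup H G \<and>
     (\<exists>S T. finite_generating_set G S \<and> finite_generating_set (G\<lparr>carrier := H\<rparr>) T \<and>
        (\<exists>\<kappa> c. qi_embedding \<kappa> c H (word_dist (G\<lparr>carrier := H\<rparr>) T) (carrier G) (word_dist G S) (\<lambda>h. h)) \<and>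
        (\<forall>\<kappa>>1. \<exists>D>0. \<forall>a\<in>H. \<forall>b\<in>H. \<forall>s t s' t' \<gamma> \<gamma>'.
           quasigeodesic_between \<kappa> s t (cayley_graph G S) (cayley_dist G S) \<gamma> (vertex a) (vertex b) \<longrightarrow>
           quasigeodesic_between \<kappa> s' t' (cayley_graph G S) (cayley_dist G S) \<gamma>' (vertex a) (vertex b) \<longrightarrow>
           hausdorff_close (cayley_dist G S) D (\<gamma> ` {s..t}) (\<gamma>' ` {s'..t'})))"

end

theory Submission
  imports Defs
begin

text \<open>The inclusion of \<open>L\<close> into \<open>G\<close> may be distorted, so quasigeodesics of \<open>L\<close> need not be
  quasigeodesics of \<open>G\<close>. What survives the inclusion is a bound on the length of a path by a
  multiple of the distance of its end points in \<open>H\<close>, as \<open>H\<close> is undistorted in \<open>G\<close>. Such a path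
  can be turned into a quasigeodesic of \<open>G\<close> that leaves it only for a small proportion of
  the distance, so stability in \<open>G\<close> forces the path to return near every portion of the geodesic
  of \<open>H\<close> of proportional length. Balls of \<open>G\<close> being finite, this recurrence also holds with
  distances measured in \<open>L\<close>, where it implies that quasigeodesics stay near geodesics of \<open>H\<close>.\<close>

subsection \<open>Chains in discrete metrics\<close>

text \<open>The obstacle is that on \<open>L\<close> no lower bound for \<open>dG\<close> by a
  linear function of \<open>dL\<close> is available: such a bound holds between points of
  \<open>H\<close>, and elsewhere only \<open>proper\<close> remains. So the lower inequality of a
  quasigeodesic of \<open>L\<close> cannot be carried to \<open>G\<close>, whereas step size and
  number of steps can. Recurrence asks only these two of the path, and its conclusion is a single
  bounded distance, so \<open>proper\<close> may distort it arbitrarily without harm. Its window has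
  length \<open>m div N\<close>, and the freedom to choose \<open>N\<close> after the distortion of
  \<open>H\<close> in \<open>L\<close> is known is what closes the contradiction in
  \<open>L\<close>. The price is that the quasigeodesic constant in \<open>G\<close> depends on
  \<open>N\<close>, on the step size and on the length ratio \<open>C\<close>, but never on
  \<open>m\<close>. All this takes place on vertices with distances in \<open>nat\<close>; real
  parameters and inner points of edges enter only in translating the stability condition to
  \<open>morse\<close> and back.\<close>

definition chain :: "'a set \<Rightarrow> ('a \<Rightarrow> 'a \<Rightarrow> nat) \<Rightarrow> nat \<Rightarrow> nat \<Rightarrow> (nat \<Rightarrow> 'a) \<Rightarrow> bool" where
  "chain X d c n p \<longleftrightarrow> (\<forall>i\<le>n. p i \<in> X) \<and> (\<forall>i<n. d (p i) (p (Suc i)) \<le> c)"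

definition glue :: "nat \<Rightarrow> (nat \<Rightarrow> 'a) \<Rightarrow> (nat \<Rightarrow> 'a) \<Rightarrow> nat \<Rightarrow> 'a" where
  "glue n p q = (\<lambda>k. if k \<le> n then p k else q (k - n))"

definition cost :: "('a \<times> 'a) set \<Rightarrow> nat \<Rightarrow> nat \<Rightarrow> (nat \<Rightarrow> 'a) \<Rightarrow> nat" where
  "cost E K n p = (\<Sum>i<n. if (p i, p (Suc i)) \<in> E then 1 else K)"

text \<open>A discrete quasi-isometric embedding of \<open>{0..n}\<close>. The lower inequality is
  multiplied out by \<open>K\<close>, which keeps everything in \<open>nat\<close>.\<close>

definition quasigeod :: "'a set \<Rightarrow> ('a \<Rightarrow> 'a \<Rightarrow> nat) \<Rightarrow> nat \<Rightarrow> nat \<Rightarrow> (nat \<Rightarrow> 'a) \<Rightarrow> bool" where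
  "quasigeod X d K n q \<longleftrightarrow> (\<forall>i\<le>n. q i \<in> X) \<and>
     (\<forall>i j. i \<le> j \<longrightarrow> j \<le> n \<longrightarrow> j - i \<le> K * d (q i) (q j) + K \<and> d (q i) (q j) \<le> K * (j - i) + K)"

text \<open>The discrete form of condition (b) of stability. One inclusion suffices, since the two
  quasigeodesics may be exchanged.\<close>

definition morse :: "'a set \<Rightarrow> 'a set \<Rightarrow> ('a \<Rightarrow> 'a \<Rightarrow> nat) \<Rightarrow> bool" where
  "morse H X d \<longleftrightarrow> (\<forall>K. \<exists>D. \<forall>n q n' q'. quasigeod X d K n q \<longrightarrow> quasigeod X d K n' q' \<longrightarrow>
     q 0 \<in> H \<longrightarrow> q n \<in> H \<longrightarrow> q' 0 = q 0 \<longrightarrow> q' n' = q n \<longrightarrow> (\<forall>i\<le>n. \<exists>j\<le>n'. d (q i) (q' j) \<le> D))"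

section \<open>Concatenation of chains and weighted length\<close>

lemma glue_simps:
  assumes "p n = q 0"
  shows "k \<le> n \<Longrightarrow> glue n p q k = p k" "glue n p q (n + k) = q k" "glue n p q 0 = p 0"
  using assms by (auto simp: glue_def)

lemma glue_image: "glue n p q ` {..n + m} \<subseteq> p ` {..n} \<union> q ` {..m}"
proof
  fix y assume "y \<in> glue n p q ` {..n + m}"
  then obtain k where k: "k \<le> n + m" "y = glue n p q k" by auto
  show "y \<in> p ` {..n} \<union> q ` {..m}"
  proof (cases "k \<le> n")
    case True
    then show ?thesis using k by (auto simp: glue_def)
  next
    case False
    then have "k - n \<in> {..m}" "y = q (k - n)" using k by (auto simp: glue_def)
    then show ?thesis by blast
  qed
qed

lemma chain_glue:
  assumes "chain X d c n p" "chain X d c m q" "p n = q 0"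
  shows "chain X d c (n + m) (glue n p q)"
  unfolding chain_def
proof (intro conjI allI impI)
  fix i assume "i \<le> n + m"
  then show "glue n p q i \<in> X" using assms by (auto simp: chain_def glue_def)
next
  fix i assume i: "i < n + m"
  show "d (glue n p q i) (glue n p q (Suc i)) \<le> c"
  proof (cases "i < n")
    case True
    then show ?thesis using assms by (auto simp: chain_def glue_def)
  next
    case False
    then obtain k where k: "i = n + k" "k < m" using i by (metis less_diff_conv2 add.commute le_add_diff_inverse not_less)
    have "glue n p q i = q k" "glue n p q (Suc i) = q (Suc k)"
      using glue_simps(2)[of p n q, OF assms(3)] k(1) by (metis, metis add_Suc_right)
    then show ?thesis using assms(2) k by (auto simp: chain_def)
  qed
qed

lemma cost_glue:
  assumes "p n = q 0"
  shows "cost E K (n + m) (glue n p q) = cost E K n p + cost E K m q"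
proof (induction m)
  case 0
  show ?case by (auto simp: cost_def glue_def intro!: sum.cong)
next
  case (Suc m)
  have "glue n p q (n + m) = q m" "glue n p q (Suc (n + m)) = q (Suc m)"
    using glue_simps(2)[of p n q, OF assms] by (metis, metis add_Suc_right)
  then show ?case using Suc by (simp add: cost_def)
qed

lemma cost_split: "cost E K (n + m) q = cost E K n q + cost E K m (\<lambda>k. q (n + k))"
  by (induction m) (auto simp: cost_def)

lemma cost_ge: "1 \<le> K \<Longrightarrow> n \<le> cost E K n p"
  unfolding cost_def using sum_mono[of "{..<n}" "\<lambda>_. 1::nat" "\<lambda>i. if (p i, p (Suc i)) \<in> E then 1 else K"] by auto

lemma cost_le: "1 \<le> K \<Longrightarrow> cost E K n p \<le> K * n"
  unfolding cost_def using sum_mono[of "{..<n}" "\<lambda>i. if (p i, p (Suc i)) \<in> E then 1 else K" "\<lambda>_. K"] by (auto simp: mult.commute)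

lemma chain_shift:
  assumes "chain X d c n q" "i + m \<le> n"
  shows "chain X d c m (\<lambda>k. q (i + k))"
  using assms by (auto simp: chain_def)

lemma chain_mono: "chain X d c n q \<Longrightarrow> c \<le> c' \<Longrightarrow> chain X d c' n q"
  unfolding chain_def by (meson le_trans)

text \<open>A discrete intermediate value theorem. It is meant for a map \<open>f\<close> that sends
  each index of a geodesic to the index of a nearby point on another path.\<close>

lemma coarse_connected:
  fixes f :: "nat \<Rightarrow> nat"
  assumes "\<And>i. a \<le> i \<Longrightarrow> i < a + b \<Longrightarrow> f (Suc i) \<le> f i + E \<and> f i \<le> f (Suc i) + E"
    and "min (f a) (f (a + b)) \<le> j" "j \<le> max (f a) (f (a + b))"
  shows "\<exists>i. a \<le> i \<and> i \<le> a + b \<and> f i \<le> j + E \<and> j \<le> f i + E"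
  using assms
proof (induction b)
  case 0
  then show ?case by (intro exI[of _ a]) auto
next
  case (Suc b)
  show ?case
  proof (cases "min (f a) (f (a + b)) \<le> j \<and> j \<le> max (f a) (f (a + b))")
    case True
    then have "\<exists>i. a \<le> i \<and> i \<le> a + b \<and> f i \<le> j + E \<and> j \<le> f i + E"
      using Suc.IH Suc.prems(1) by simp
    then show ?thesis by (meson add_le_mono le_SucI le_trans nle_le order.refl le_add2 add_Suc_right)
  next
    case False
    \<comment> \<open>Here \<open>j\<close> lies between the last two values, which differ by at
      most \<open>E\<close>, so the index \<open>a + b\<close> works.\<close>
    have "f (Suc (a + b)) \<le> f (a + b) + E \<and> f (a + b) \<le> f (Suc (a + b)) + E"
      using Suc.prems(1)[of "a + b"] by simp
    then show ?thesis using False Suc.prems(2,3)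
      by (intro exI[of _ "a + b"]) (auto simp: min_def max_def split: if_splits)
  qed
qed

text \<open>Models the vertex set of a connected graph with its path metric.\<close>

locale geodesic_nat_metric =
  fixes X :: "'a set" and d :: "'a \<Rightarrow> 'a \<Rightarrow> nat"
  assumes zero_iff: "x \<in> X \<Longrightarrow> y \<in> X \<Longrightarrow> d x y = 0 \<longleftrightarrow> x = y"
    and sym: "x \<in> X \<Longrightarrow> y \<in> X \<Longrightarrow> d x y = d y x"
    and tri: "x \<in> X \<Longrightarrow> y \<in> X \<Longrightarrow> z \<in> X \<Longrightarrow> d x z \<le> d x y + d y z"
    and geodesic_chain: "x \<in> X \<Longrightarrow> y \<in> X \<Longrightarrow> \<exists>p. chain X d 1 (d x y) p \<and> p 0 = x \<and> p (d x y) = y"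
begin

section \<open>Geodesics and surgery in an integer-valued metric\<close>

lemma chain_dist:
  assumes "chain X d c n p" "i \<le> j" "j \<le> n"
  shows "d (p i) (p j) \<le> c * (j - i)"
  using assms(2,3)
proof (induction j rule: dec_induct)
  case base
  then show ?case using assms(1) zero_iff by (simp add: chain_def)
next
  case (step j)
  have "d (p i) (p (Suc j)) \<le> d (p i) (p j) + d (p j) (p (Suc j))"
    using step assms(1) by (intro tri) (auto simp: chain_def)
  also have "\<dots> \<le> c * (j - i) + c"
    using step assms(1) by (intro add_mono) (auto simp: chain_def)
  finally show ?case using step by (simp add: Suc_diff_le)
qed

text \<open>A chain of \<open>d x y\<close> steps of length at most 1 has no slack: if a section
  were shorter than its number of steps, the triangle inequality would put \<open>x\<close> and
  \<open>y\<close> closer together than they are.\<close>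

lemma geodesic:
  assumes "x \<in> X" "y \<in> X"
  obtains p where "chain X d 1 (d x y) p" "p 0 = x" "p (d x y) = y"
    "\<And>i j. i \<le> j \<Longrightarrow> j \<le> d x y \<Longrightarrow> d (p i) (p j) = j - i"
proof -
  obtain p where p: "chain X d 1 (d x y) p" "p 0 = x" "p (d x y) = y"
    using geodesic_chain[OF assms] by blast
  have "d (p i) (p j) = j - i" if ij: "i \<le> j" "j \<le> d x y" for i j
  proof -
    have X: "p i \<in> X" "p j \<in> X" using p(1) ij by (auto simp: chain_def)
    have "d x y \<le> d x (p i) + d (p i) y" using assms X tri by blast
    moreover have "d (p i) y \<le> d (p i) (p j) + d (p j) y" using assms X tri by blast
    moreover have "d x (p i) \<le> i" "d (p i) (p j) \<le> j - i" "d (p j) y \<le> d x y - j"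
      using chain_dist[OF p(1), of 0 i] chain_dist[OF p(1), of i j] chain_dist[OF p(1), of j "d x y"] ij p
      by auto
    ultimately show ?thesis using ij by linarith
  qed
  then show ?thesis using that p by blast
qed

lemma chain_rev:
  assumes "chain X d c n p"
  shows "chain X d c n (\<lambda>k. p (n - k))"
  unfolding chain_def
proof (intro conjI allI impI)
  fix i assume "i < n"
  then have "Suc (n - Suc i) = n - i" "n - Suc i < n" by auto
  moreover from this have "d (p (n - Suc i)) (p (Suc (n - Suc i))) \<le> c"
    using assms unfolding chain_def by blast
  moreover have "p (n - i) \<in> X" "p (n - Suc i) \<in> X" using assms by (auto simp: chain_def)
  ultimately show "d (p (n - i)) (p (n - Suc i)) \<le> c" using sym by metis
qed (use assms in \<open>auto simp: chain_def\<close>)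

text \<open>Both orders of the indices are allowed, because points of \<open>q\<close> chosen near
  two successive points of another path may come in reverse order.\<close>

lemma chain_between:
  assumes "chain X d c n q" "i \<le> n" "j \<le> n"
  obtains p l where "chain X d c l p" "p 0 = q i" "p l = q j" "p ` {..l} \<subseteq> q ` {..n}"
    "l = (if i \<le> j then j - i else i - j)"
proof (cases "i \<le> j")
  case True
  have "chain X d c (j - i) (\<lambda>k. q (i + k))" using chain_shift[OF assms(1)] assms True by simp
  moreover have "(\<lambda>k. q (i + k)) ` {..j - i} \<subseteq> q ` {..n}" using assms True by (auto intro!: imageI)
  ultimately show ?thesis using True by (intro that) auto
next
  case False
  have "chain X d c (i - j) (\<lambda>k. q (j + (i - j - k)))"
    using chain_rev[OF chain_shift[OF assms(1), of j "i - j"]] assms False by simp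
  moreover have "(\<lambda>k. q (j + (i - j - k))) ` {..i - j} \<subseteq> q ` {..n}"
    using assms False by (auto intro!: imageI)
  ultimately show ?thesis using False by (intro that[of "i - j" "\<lambda>k. q (j + (i - j - k))"]) auto
qed

text \<open>Steps along \<open>p\<close> cost 1, all others cost \<open>K\<close>. A chain of minimal cost is a quasigeodesic,
  because each of its segments competes with a geodesic, and it leaves \<open>p\<close> only briefly.\<close>

lemma surgery:
  assumes p: "chain X d c n p" and c: "1 \<le> c" and K: "1 \<le> K"
  obtains N q where "chain X d c N q" "q 0 = p 0" "q N = p n"
    "\<And>i j. i \<le> j \<Longrightarrow> j \<le> N \<Longrightarrow> j - i \<le> K * d (q i) (q j)"
    "\<And>i j. i \<le> j \<Longrightarrow> j \<le> N \<Longrightarrow> q ` {i..j} \<inter> p ` {..n} = {} \<Longrightarrow> K * (j - i) \<le> n"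
proof -
  \<comment> \<open>The pairs are directed, so running backwards along \<open>p\<close> costs
    \<open>K\<close>. Two facts about \<open>E\<close> matter: \<open>p\<close> itself costs
    \<open>n\<close>, and every pair in \<open>E\<close> starts on \<open>p\<close>.\<close>
  define E where "E = (\<lambda>i. (p i, p (Suc i))) ` {..<n}"
  define P where "P = (\<lambda>(N, q). chain X d c N q \<and> q 0 = p 0 \<and> q N = p n)"
  have "P (n, p)" using p by (simp add: P_def)
  then obtain Nq where "P Nq" and min': "\<And>Nr. P Nr \<Longrightarrow> cost E K (fst Nq) (snd Nq) \<le> cost E K (fst Nr) (snd Nr)"
    using ex_has_least_nat[of P "(n, p)" "\<lambda>Nr. cost E K (fst Nr) (snd Nr)"] by blast
  then obtain N q where q: "chain X d c N q" "q 0 = p 0" "q N = p n"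
    and min: "\<And>M r. chain X d c M r \<Longrightarrow> r 0 = p 0 \<Longrightarrow> r M = p n \<Longrightarrow> cost E K N q \<le> cost E K M r"
    by (cases Nq) (force simp: P_def)
  \<comment> \<open>\<open>p\<close> is a competitor, so the minimal cost is at most
    \<open>n\<close>; this is what limits the sections off \<open>p\<close>.\<close>
  have "cost E K n p = n" by (simp add: cost_def E_def)
  then have total: "cost E K N q \<le> n" using min[OF p] by simp
  have split: "cost E K N q = cost E K i q + (cost E K (j - i) (\<lambda>k. q (i + k)) + cost E K (N - j) (\<lambda>k. q (j + k)))"
    if "i \<le> j" "j \<le> N" for i j
    using cost_split[of E K i "N - i" q] cost_split[of E K "j - i" "N - j" "\<lambda>k. q (i + k)"] that
    by (simp add: add.assoc[symmetric])
  show ?thesis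
  proof (rule that[OF q])
    fix i j assume ij: "i \<le> j" "j \<le> N"
    have X: "q i \<in> X" "q j \<in> X" using q(1) ij by (auto simp: chain_def)
    define e where "e = d (q i) (q j)"
    obtain g where g: "chain X d 1 e g" "g 0 = q i" "g e = q j"
      using geodesic_chain[OF X] by (auto simp: e_def)
    define s where "s = glue e g (\<lambda>k. q (j + k))"
    have tail: "chain X d c (N - j) (\<lambda>k. q (j + k))" using chain_shift[OF q(1)] ij by simp
    have s: "chain X d c (e + (N - j)) s"
      unfolding s_def using chain_glue[OF chain_mono[OF g(1) c] tail] g by simp
    have s_simps: "s 0 = q i" "s (e + (N - j)) = q N"
      using glue_simps(3)[of g e "\<lambda>k. q (j + k)"] glue_simps(2)[of g e "\<lambda>k. q (j + k)" "N - j"] g ij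
      by (simp_all add: s_def del: add_diff_assoc)
    have head: "chain X d c i q" using q(1) ij by (auto simp: chain_def)
    have r: "chain X d c (i + (e + (N - j))) (glue i q s)"
      using chain_glue[OF head s] s_simps by simp
    have "cost E K N q \<le> cost E K (i + (e + (N - j))) (glue i q s)"
      using glue_simps[of q i s] s_simps q by (intro min[OF r]) auto
    also have "\<dots> = cost E K i q + (cost E K e g + cost E K (N - j) (\<lambda>k. q (j + k)))"
      using cost_glue[of q i s E K "e + (N - j)"] cost_glue[of g e "\<lambda>k. q (j + k)" E K "N - j"] s_simps g
      by (simp add: s_def)
    \<comment> \<open>Each step counts at least 1 on the left and at most \<open>K\<close> on the
      right.\<close>
    finally have "cost E K (j - i) (\<lambda>k. q (i + k)) \<le> cost E K e g" using split[OF ij] by simp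
    then show "j - i \<le> K * d (q i) (q j)"
      using cost_ge[OF K, of "j - i" E "\<lambda>k. q (i + k)"] cost_le[OF K, of E e g] by (simp add: e_def)
  next
    fix i j assume ij: "i \<le> j" "j \<le> N" and off: "q ` {i..j} \<inter> p ` {..n} = {}"
    have "(q (i + k), q (Suc (i + k))) \<notin> E" if "k < j - i" for k
    proof
      assume "(q (i + k), q (Suc (i + k))) \<in> E"
      then have "q (i + k) \<in> p ` {..n}" by (auto simp: E_def)
      moreover have "q (i + k) \<in> q ` {i..j}" using that by auto
      ultimately show False using off by blast
    qed
    then have "cost E K (j - i) (\<lambda>k. q (i + k)) = (\<Sum>k<j - i. K)"
      unfolding cost_def by (intro sum.cong) auto
    then show "K * (j - i) \<le> n" using split[OF ij] total by (simp add: mult.commute)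
  qed
qed

end

subsection \<open>Recurrence and its consequences\<close>

text \<open>\<open>A\<close> records that \<open>H\<close> is undistorted in \<open>G\<close>,
  \<open>B\<close> and \<open>M\<close> that inclusions are Lipschitz. For \<open>L\<close> in
  \<open>G\<close> the only lower control is \<open>proper\<close>, with no rate. The bounds are
  purely multiplicative: between distinct points distances are at least 1, so additive constants can
  be absorbed.\<close>

locale subgroup_metrics =
  mH: geodesic_nat_metric H dH + mL: geodesic_nat_metric L dL + mG: geodesic_nat_metric G dG
  for H L G :: "'a set" and dH dL dG :: "'a \<Rightarrow> 'a \<Rightarrow> nat" +
  fixes A B M :: nat
  assumes HL: "H \<subseteq> L" and LG: "L \<subseteq> G"
    and pos: "1 \<le> A" "1 \<le> B" "1 \<le> M"
    and dH_le: "x \<in> H \<Longrightarrow> y \<in> H \<Longrightarrow> dH x y \<le> A * dG x y"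
    and dL_le: "x \<in> H \<Longrightarrow> y \<in> H \<Longrightarrow> dL x y \<le> B * dH x y"
    and dG_le: "x \<in> L \<Longrightarrow> y \<in> L \<Longrightarrow> dG x y \<le> M * dL x y"
    and proper: "\<exists>D'. \<forall>x\<in>L. \<forall>y\<in>L. dG x y \<le> D \<longrightarrow> dL x y \<le> D'"
    and morse_G: "morse H G dG"
begin

text \<open>Geodesics of \<open>H\<close> serve as reference paths because they are quasigeodesics
  for \<open>dL\<close> and for \<open>dG\<close> alike.\<close>

definition geodesic_H :: "nat \<Rightarrow> (nat \<Rightarrow> 'a) \<Rightarrow> bool" where
  "geodesic_H m \<alpha> \<longleftrightarrow> (\<forall>i\<le>m. \<alpha> i \<in> H) \<and> (\<forall>i j. i \<le> j \<longrightarrow> j \<le> m \<longrightarrow> dH (\<alpha> i) (\<alpha> j) = j - i)"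

section \<open>Comparison of the three metrics\<close>

lemma dG_le_dH:
  assumes "x \<in> H" "y \<in> H"
  shows "dG x y \<le> M * B * dH x y"
proof -
  have "dG x y \<le> M * dL x y" using dG_le assms HL by blast
  also have "\<dots> \<le> M * (B * dH x y)" using dL_le assms by simp
  finally show ?thesis by (simp add: mult.assoc)
qed

text \<open>Undistortion passes to any intermediate group, since \<open>dG\<close> is at most
  \<open>M * dL\<close> on \<open>L\<close>. This yields condition (a) for \<open>H\<close> in
  \<open>L\<close>.\<close>

lemma dH_le_dL:
  assumes "x \<in> H" "y \<in> H"
  shows "dH x y \<le> A * M * dL x y"
proof -
  have "dH x y \<le> A * dG x y" using dH_le assms by blast
  also have "\<dots> \<le> A * (M * dL x y)" using dG_le[of x y] assms HL by (intro mult_le_mono2) blast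
  finally show ?thesis by (simp add: mult.assoc)
qed

lemma chain_L_G: "chain L dL c n p \<Longrightarrow> chain G dG (M * c) n p"
  unfolding chain_def
proof (intro conjI allI impI)
  fix i assume p: "(\<forall>i\<le>n. p i \<in> L) \<and> (\<forall>i<n. dL (p i) (p (Suc i)) \<le> c)" and "i < n"
  then have "dG (p i) (p (Suc i)) \<le> M * dL (p i) (p (Suc i))" by (intro dG_le) auto
  also have "\<dots> \<le> M * c" using p \<open>i < n\<close> by simp
  finally show "dG (p i) (p (Suc i)) \<le> M * c" .
qed (use LG in auto)

lemma geodesic_H_dist_L:
  assumes "geodesic_H m \<alpha>" "i \<le> m" "j \<le> m"
  shows "dL (\<alpha> i) (\<alpha> j) \<le> B * (if i \<le> j then j - i else i - j)"
proof -
  have H: "\<alpha> i \<in> H" "\<alpha> j \<in> H" using assms by (auto simp: geodesic_H_def)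
  have "dH (\<alpha> i) (\<alpha> j) = (if i \<le> j then j - i else i - j)"
    using assms mH.sym[OF H] by (auto simp: geodesic_H_def)
  then show ?thesis using dL_le[OF H] by simp
qed

text \<open>Surgery turns \<open>p\<close> into a quasigeodesic \<open>q\<close> with constants
  independent of \<open>m\<close>, so \<open>\<alpha>\<close> stays near \<open>q\<close>. If
  \<open>p\<close> kept away from a window of \<open>\<alpha>\<close> of length
  \<open>m div N\<close>, the section of \<open>q\<close> that shadows the window would be disjoint
  from \<open>p\<close>, hence too short to span it.\<close>

lemma recurrence_G:
  assumes c: "1 \<le> c" and C: "1 \<le> C" and N: "2 \<le> N"
  shows "\<exists>D. \<forall>n p m \<alpha> i0. chain G dG c n p \<longrightarrow> geodesic_H m \<alpha> \<longrightarrow> \<alpha> 0 = p 0 \<longrightarrow> \<alpha> m = p n \<longrightarrow>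
     n \<le> C * m \<longrightarrow> i0 \<le> m \<longrightarrow>
     (\<exists>i\<le>m. \<exists>k\<le>n. i \<le> i0 + m div N \<and> i0 \<le> i + m div N \<and> dG (\<alpha> i) (p k) \<le> D)"
proof -
  \<comment> \<open>A section of \<open>q\<close> off \<open>p\<close> has at most
    \<open>n / K0\<close>, hence at most \<open>m / (2 * A * c * N)\<close> steps. Its
    \<open>dG\<close>-length times \<open>A\<close> is then at most half of
    \<open>m / N\<close>.\<close>
  define K0 where "K0 = 2 * A * c * C * N"
  \<comment> \<open>\<open>K0\<close> and \<open>c\<close> are the lower and upper constants of
    \<open>q\<close>, \<open>A\<close> and \<open>M * B\<close> those of
    \<open>\<alpha>\<close>.\<close>
  define K where "K = K0 + c + A + M * B"
  have K0: "1 \<le> K0" using pos c C N by (simp add: K0_def)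
  obtain D1 where D1: "\<And>n q n' q'. quasigeod G dG K n q \<Longrightarrow> quasigeod G dG K n' q' \<Longrightarrow>
     q 0 \<in> H \<Longrightarrow> q n \<in> H \<Longrightarrow> q' 0 = q 0 \<Longrightarrow> q' n' = q n \<Longrightarrow> \<forall>i\<le>n. \<exists>j\<le>n'. dG (q i) (q' j) \<le> D1"
    using morse_G unfolding morse_def by blast
  \<comment> \<open>\<open>E\<close> bounds the jumps of the index map \<open>f\<close> from
    \<open>\<alpha>\<close> to \<open>q\<close>, \<open>D2\<close> the distance to
    \<open>\<alpha>\<close> of points of \<open>q\<close> whose index is within \<open>E\<close> of
    a value of \<open>f\<close>. The extra term of \<open>D3\<close> serves the case of bounded
    \<open>m\<close>.\<close>
  define E where "E = K0 * (2 * D1 + M * B)"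
  define D2 where "D2 = D1 + c * E"
  define D3 where "D3 = D2 + M * B * (N * (4 * A * D1 + 1))"
  show ?thesis
  proof (rule exI[of _ D3], intro allI impI)
    fix n p m \<alpha> i0
    assume p: "chain G dG c n p" and \<alpha>: "geodesic_H m \<alpha>" and ends: "\<alpha> 0 = p 0" "\<alpha> m = p n"
      and n: "n \<le> C * m" and i0: "i0 \<le> m"
    define e where "e = m div N"
    have \<alpha>H: "\<alpha> i \<in> H" if "i \<le> m" for i using \<alpha> that by (auto simp: geodesic_H_def)
    have HG: "x \<in> G" if "x \<in> H" for x using that HL LG by auto
    have \<alpha>d: "dH (\<alpha> i) (\<alpha> j) = j - i" if "i \<le> j" "j \<le> m" for i j using \<alpha> that by (auto simp: geodesic_H_def)
    have \<alpha>u: "dG (\<alpha> i) (\<alpha> j) \<le> M * B * (j - i)" if "i \<le> j" "j \<le> m" for i j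
      using dG_le_dH[OF \<alpha>H \<alpha>H, of i j] \<alpha>d[OF that] that by simp
    have \<alpha>l: "j - i \<le> A * dG (\<alpha> i) (\<alpha> j)" if "i \<le> j" "j \<le> m" for i j
      using dH_le[OF \<alpha>H \<alpha>H, of i j] \<alpha>d[OF that] that by simp
    show "\<exists>i\<le>m. \<exists>k\<le>n. i \<le> i0 + m div N \<and> i0 \<le> i + m div N \<and> dG (\<alpha> i) (p k) \<le> D3"
    proof (cases "e \<le> 4 * A * D1")
      \<comment> \<open>In this case \<open>m\<close> is bounded, and the common starting point
        \<open>p 0\<close> is already near \<open>\<alpha> i0\<close>.\<close>
      case True
      have "m = N * e + m mod N" unfolding e_def by simp
      also have "\<dots> \<le> N * e + N" using N by (intro add_left_mono less_imp_le mod_less_divisor) simp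
      also have "\<dots> \<le> N * (4 * A * D1 + 1)" using True by simp
      finally have "m \<le> N * (4 * A * D1 + 1)" .
      then have le: "i0 \<le> N * (4 * A * D1 + 1)" using i0 by simp
      have "dG (\<alpha> i0) (p 0) = dG (\<alpha> 0) (\<alpha> i0)" using mG.sym[of "\<alpha> i0" "\<alpha> 0"] HG \<alpha>H[of 0] \<alpha>H[of i0] i0 ends by simp
      also have "\<dots> \<le> M * B * i0" using \<alpha>u[of 0 i0] i0 by simp
      also have "\<dots> \<le> M * B * (N * (4 * A * D1 + 1))" by (intro mult_le_mono2 le)
      finally have "dG (\<alpha> i0) (p 0) \<le> D3" by (simp add: D3_def)
      then show ?thesis using i0 by (intro exI[of _ i0]) auto
    next
      case False
      have e2: "2 * e \<le> m"
      proof -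
        have "2 * e \<le> N * e" using N by simp
        also have "\<dots> \<le> m" unfolding e_def by simp
        finally show ?thesis .
      qed
      \<comment> \<open>A full window of length \<open>e\<close> that contains \<open>i0\<close>
        must fit into \<open>{0..m}\<close>. Near the right end it is moved to the left of
        \<open>i0\<close>, where \<open>2 * e \<le> m\<close> leaves room.\<close>
      obtain i1 where i1: "i1 + e \<le> m" "i1 \<le> i0" "i0 \<le> i1 + e"
      proof (cases "i0 + e \<le> m")
        case True
        then show ?thesis using that[of i0] by simp
      next
        case False
        then show ?thesis using that[of "i0 - e"] e2 i0 by simp
      qed
      obtain T q where q: "chain G dG c T q" "q 0 = p 0" "q T = p n"
        and ql: "\<And>i j. i \<le> j \<Longrightarrow> j \<le> T \<Longrightarrow> j - i \<le> K0 * dG (q i) (q j)"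
        and qoff: "\<And>i j. i \<le> j \<Longrightarrow> j \<le> T \<Longrightarrow> q ` {i..j} \<inter> p ` {..n} = {} \<Longrightarrow> K0 * (j - i) \<le> n"
        using mG.surgery[OF p c K0] by blast
      have qG: "q i \<in> G" if "i \<le> T" for i using q(1) that by (auto simp: chain_def)
      have qu: "dG (q i) (q j) \<le> c * (j - i)" if "i \<le> j" "j \<le> T" for i j
        by (rule mG.chain_dist[OF q(1) that])
      have mono: "k \<le> K \<Longrightarrow> x \<le> k * y \<Longrightarrow> x \<le> K * y + K" for k x y :: nat
        by (meson le_trans mult_le_mono1 trans_le_add1)
      have "quasigeod G dG K T q" unfolding quasigeod_def
        using qG mono[of K0, OF _ ql] mono[of c, OF _ qu] by (auto simp: K_def)
      moreover have "quasigeod G dG K m \<alpha>" unfolding quasigeod_def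
        using HG \<alpha>H mono[of A, OF _ \<alpha>l] mono[of "M * B", OF _ \<alpha>u] by (auto simp: K_def)
      ultimately have "\<forall>i\<le>m. \<exists>j\<le>T. dG (\<alpha> i) (q j) \<le> D1"
        using D1[of m \<alpha> T q] \<alpha>H[of 0] \<alpha>H[of m] ends q by simp
      then obtain f where f: "\<And>i. i \<le> m \<Longrightarrow> f i \<le> T \<and> dG (\<alpha> i) (q (f i)) \<le> D1" by metis
      have f_step: "f (Suc i) \<le> f i + E \<and> f i \<le> f (Suc i) + E" if "Suc i \<le> m" for i
      proof -
        have X: "\<alpha> i \<in> G" "\<alpha> (Suc i) \<in> G" "q (f i) \<in> G" "q (f (Suc i)) \<in> G"
          using that HG \<alpha>H qG f by auto
        have "dG (q (f i)) (q (f (Suc i))) \<le> dG (q (f i)) (\<alpha> i) + (dG (\<alpha> i) (\<alpha> (Suc i)) + dG (\<alpha> (Suc i)) (q (f (Suc i))))"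
          using mG.tri[OF X(3,1,4)] mG.tri[OF X(1,2,4)] by simp
        also have "\<dots> \<le> 2 * D1 + M * B"
          using \<alpha>u[of i "Suc i"] f[of i] f[of "Suc i"] that mG.sym[OF X(1,3)] by simp
        finally have le: "dG (q (f i)) (q (f (Suc i))) \<le> 2 * D1 + M * B" .
        then have le': "dG (q (f (Suc i))) (q (f i)) \<le> 2 * D1 + M * B" using mG.sym[OF X(3,4)] by simp
        show ?thesis
        proof (cases "f i \<le> f (Suc i)")
          case True
          have "f (Suc i) - f i \<le> K0 * (2 * D1 + M * B)"
            by (rule le_trans[OF ql mult_le_mono2[OF le]]) (use True f that in auto)
          then show ?thesis using True by (simp add: E_def)
        next
          case False
          have "f i - f (Suc i) \<le> K0 * (2 * D1 + M * B)"
            by (rule le_trans[OF ql mult_le_mono2[OF le']]) (use False f that in auto)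
          then show ?thesis using False by (simp add: E_def)
        qed
      qed
      show ?thesis
      proof (rule ccontr)
        assume "\<not> ?thesis"
        then have far: "\<not> dG (\<alpha> i) (p k) \<le> D2" if "i1 \<le> i" "i \<le> i1 + e" "k \<le> n" for i k
          using that i1 unfolding e_def[symmetric] D3_def by (meson add_le_mono le_trans le_add1 order.refl)
        \<comment> \<open>The map \<open>f\<close> need not be monotone, so the images of the two
          ends of the window are put in order.\<close>
        define lo hi where "lo = min (f i1) (f (i1 + e))" and "hi = max (f i1) (f (i1 + e))"
        have lohi: "lo \<le> hi" "hi \<le> T" using f i1 by (auto simp: lo_def hi_def)
        have "q j \<notin> p ` {..n}" if j: "lo \<le> j" "j \<le> hi" for j
        proof
          assume "q j \<in> p ` {..n}"
          then obtain k where k: "k \<le> n" "q j = p k" by auto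
          \<comment> \<open>A point of \<open>p\<close> at index \<open>j\<close> of
            \<open>q\<close> would be within \<open>D2\<close> of \<open>\<alpha> i\<close> for some
            \<open>i\<close> of the window.\<close>
          obtain i where i: "i1 \<le> i" "i \<le> i1 + e" "f i \<le> j + E" "j \<le> f i + E"
            using coarse_connected[of i1 e f E j] f_step j i1 unfolding lo_def hi_def by auto
          have im: "i \<le> m" "f i \<le> T" "j \<le> T" using i i1 f j lohi by auto
          have "dG (q (f i)) (q j) \<le> c * E"
          proof (cases "f i \<le> j")
            case True
            have "dG (q (f i)) (q j) \<le> c * (j - f i)" using qu True im by simp
            also have "\<dots> \<le> c * E" using i by (intro mult_le_mono2) simp
            finally show ?thesis .
          next
            case False
            have "dG (q (f i)) (q j) = dG (q j) (q (f i))" using mG.sym qG im by simp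
            also have "\<dots> \<le> c * (f i - j)" using qu False im by simp
            also have "\<dots> \<le> c * E" using i by (intro mult_le_mono2) simp
            finally show ?thesis .
          qed
          then have "dG (\<alpha> i) (q j) \<le> D2"
            using mG.tri[OF HG[OF \<alpha>H] qG qG, of i "f i" j] f[of i] im by (simp add: D2_def)
          then show False using far[of i k] i k by simp
        qed
        then have "q ` {lo..hi} \<inter> p ` {..n} = {}" unfolding disjoint_iff by (metis atLeastAtMost_iff imageE)
        then have "K0 * (hi - lo) \<le> n" by (intro qoff lohi)
        also have "\<dots> \<le> C * m" by (rule n)
        finally have "C * (2 * A * c * N * (hi - lo)) \<le> C * m" by (simp add: K0_def mult_ac)
        then have "2 * A * c * N * (hi - lo) \<le> m" using C by simp
        then have "N * (2 * A * c * (hi - lo)) \<le> m" by (simp add: mult_ac)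
        then have short: "2 * A * c * (hi - lo) \<le> e"
          unfolding e_def using N by (simp add: less_eq_div_iff_mult_less_eq mult.commute)
        have m: "i1 \<le> m" "i1 + e \<le> m" using i1 by auto
        have X: "\<alpha> i1 \<in> G" "\<alpha> (i1 + e) \<in> G" "q (f i1) \<in> G" "q (f (i1 + e)) \<in> G"
          using HG \<alpha>H qG f m by auto
        have "dG (q (f i1)) (q (f (i1 + e))) = dG (q lo) (q hi)"
          using mG.sym[OF X(3,4)] by (auto simp: lo_def hi_def min_def max_def)
        also have "\<dots> \<le> c * (hi - lo)" by (rule qu[OF lohi])
        finally have "dG (q (f i1)) (q (f (i1 + e))) \<le> c * (hi - lo)" .
        then have le: "dG (\<alpha> i1) (\<alpha> (i1 + e)) \<le> 2 * D1 + c * (hi - lo)"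
          using mG.tri[OF X(1,3,2)] mG.tri[OF X(3,4,2)] mG.sym[OF X(2,4)] f[OF m(1)] f[OF m(2)] by simp
        \<comment> \<open>Undistortion of \<open>H\<close> makes the window long in
          \<open>dG\<close>, while \<open>q\<close> crosses it by a short section. Doubling lets
          \<open>short\<close> absorb one \<open>e\<close>, which leaves
          \<open>e \<le> 4 * A * D1\<close>, against the case assumption.\<close>
        have "e \<le> A * dG (\<alpha> i1) (\<alpha> (i1 + e))" using \<alpha>l[of i1 "i1 + e"] m by simp
        also have "\<dots> \<le> A * (2 * D1 + c * (hi - lo))" by (rule mult_le_mono2[OF le])
        finally have "2 * e \<le> 4 * A * D1 + 2 * A * c * (hi - lo)" by (simp add: algebra_simps)
        then show False using short False by simp
      qed
    qed
  qed
qed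

text \<open>A chain of \<open>L\<close> is a chain of \<open>G\<close> with the same number of
  steps, so \<open>n \<le> C * m\<close> is unaffected. The near points found in \<open>G\<close>
  both lie in \<open>L\<close>, and \<open>proper\<close> bounds their distance there.\<close>

lemma recurrence_L:
  assumes "1 \<le> C" and "2 \<le> N"
  obtains D where "\<And>n p m \<alpha> i0. chain L dL c n p \<Longrightarrow> geodesic_H m \<alpha> \<Longrightarrow> \<alpha> 0 = p 0 \<Longrightarrow> \<alpha> m = p n \<Longrightarrow>
     n \<le> C * m \<Longrightarrow> i0 \<le> m \<Longrightarrow>
     \<exists>i\<le>m. \<exists>k\<le>n. i \<le> i0 + m div N \<and> i0 \<le> i + m div N \<and> dL (\<alpha> i) (p k) \<le> D"
proof -
  \<comment> \<open>Adding 1 provides the positive step size that \<open>recurrence_G\<close>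
    requires, also when \<open>c\<close> is 0.\<close>
  have Mc: "1 \<le> M * c + 1" by simp
  obtain D where D: "\<And>n p m \<alpha> i0. chain G dG (M * c + 1) n p \<Longrightarrow> geodesic_H m \<alpha> \<Longrightarrow> \<alpha> 0 = p 0 \<Longrightarrow> \<alpha> m = p n \<Longrightarrow>
     n \<le> C * m \<Longrightarrow> i0 \<le> m \<Longrightarrow>
     \<exists>i\<le>m. \<exists>k\<le>n. i \<le> i0 + m div N \<and> i0 \<le> i + m div N \<and> dG (\<alpha> i) (p k) \<le> D"
    using recurrence_G[OF Mc assms] by blast
  obtain D' where D': "\<forall>x\<in>L. \<forall>y\<in>L. dG x y \<le> D \<longrightarrow> dL x y \<le> D'" using proper by blast
  show ?thesis
  proof (rule that[of D'])
    fix n p m \<alpha> i0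
    assume p: "chain L dL c n p" and \<alpha>: "geodesic_H m \<alpha>" and "\<alpha> 0 = p 0" "\<alpha> m = p n" "n \<le> C * m" "i0 \<le> m"
    moreover have "chain G dG (M * c + 1) n p" using chain_mono[OF chain_L_G[OF p]] by simp
    ultimately obtain i k where "i \<le> m" "k \<le> n" "i \<le> i0 + m div N" "i0 \<le> i + m div N" "dG (\<alpha> i) (p k) \<le> D"
      using D by blast
    moreover from this have "\<alpha> i \<in> L" "p k \<in> L" using \<alpha> p HL by (auto simp: geodesic_H_def chain_def)
    ultimately show "\<exists>i\<le>m. \<exists>k\<le>n. i \<le> i0 + m div N \<and> i0 \<le> i + m div N \<and> dL (\<alpha> i) (p k) \<le> D'"
      using D' by blast
  qed
qed

section \<open>From recurrence to neighbourhoods of geodesics\<close>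

lemma geodesic_H_shift: "geodesic_H m \<alpha> \<Longrightarrow> i + k \<le> m \<Longrightarrow> geodesic_H k (\<lambda>j. \<alpha> (i + j))"
  by (auto simp: geodesic_H_def)

text \<open>If \<open>\<alpha> i0\<close> is at the maximal distance \<open>R\<close> from \<open>q\<close>, then a stretch of \<open>\<alpha>\<close> of length
  comparable to \<open>R\<close> around it can be bypassed along \<open>q\<close> by a chain of comparable length
  that avoids the ball of radius \<open>R\<close> around \<open>\<alpha> i0\<close>; recurrence bounds \<open>R\<close>.\<close>

lemma geodesic_near_quasigeod:
  obtains R where "\<And>n q m \<alpha>. quasigeod L dL K n q \<Longrightarrow> geodesic_H m \<alpha> \<Longrightarrow> \<alpha> 0 = q 0 \<Longrightarrow> \<alpha> m = q n \<Longrightarrow>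
     \<forall>i\<le>m. \<exists>j\<le>n. dL (\<alpha> i) (q j) \<le> R"
proof -
  define A' where "A' = A * M"
  \<comment> \<open>The stretch has length \<open>m' \<le> 4 * A' * R\<close>, so a window of
    \<open>m' div N\<close> indices has \<open>dL\<close>-length at most
    \<open>R / 2\<close>.\<close>
  define N where "N = 8 * A' * B"
  \<comment> \<open>The summands pay for the two connecting geodesics, for the distance between
    their ends on \<open>q\<close>, and for the additive constant of \<open>q\<close>.\<close>
  define C where "C = 2 * B + K * (3 * B) + K"
  \<comment> \<open>Consecutive points of \<open>q\<close> are at distance at most
    \<open>2 * K\<close>; the extra 1 admits unit steps even for \<open>K = 0\<close>.\<close>
  define c where "c = 2 * K + 1"
  have A': "1 \<le> A'" using pos by (simp add: A'_def)
  have "1 \<le> A' * B" using A' pos by simp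
  then have N: "2 \<le> N" by (simp add: N_def)
  have C: "1 \<le> C" using pos by (simp add: C_def)
  obtain D where D: "\<And>n p m \<alpha> i0. chain L dL c n p \<Longrightarrow> geodesic_H m \<alpha> \<Longrightarrow> \<alpha> 0 = p 0 \<Longrightarrow> \<alpha> m = p n \<Longrightarrow>
     n \<le> C * m \<Longrightarrow> i0 \<le> m \<Longrightarrow>
     \<exists>i\<le>m. \<exists>k\<le>n. i \<le> i0 + m div N \<and> i0 \<le> i + m div N \<and> dL (\<alpha> i) (p k) \<le> D"
    using recurrence_L[OF C N] by blast
  show ?thesis
  proof (rule that[of "2 * D"])
    fix n q m \<alpha>
    assume q: "quasigeod L dL K n q" and \<alpha>: "geodesic_H m \<alpha>" and ends: "\<alpha> 0 = q 0" "\<alpha> m = q n"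
    have \<alpha>H: "\<alpha> i \<in> H" if "i \<le> m" for i using \<alpha> that by (auto simp: geodesic_H_def)
    have \<alpha>L: "\<alpha> i \<in> L" if "i \<le> m" for i using \<alpha>H[OF that] HL by auto
    have qL: "q j \<in> L" if "j \<le> n" for j using q that by (auto simp: quasigeod_def)
    have ql: "j - i \<le> K * dL (q i) (q j) + K" if "i \<le> n" "j \<le> n" for i j
      using q that unfolding quasigeod_def by (cases "i \<le> j") auto
    have qc: "chain L dL c n q"
      unfolding chain_def
    proof (intro conjI allI impI)
      fix i assume "i < n"
      then have "dL (q i) (q (Suc i)) \<le> K * (Suc i - i) + K"
        using q unfolding quasigeod_def by (metis Suc_leI le_SucI order.refl)
      then show "dL (q i) (q (Suc i)) \<le> c" by (simp add: c_def)
    qed (use qL in auto)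
    define R where "R = (LEAST R. \<forall>i\<le>m. \<exists>j\<le>n. dL (\<alpha> i) (q j) \<le> R)"
    have near: "\<forall>i\<le>m. \<exists>j\<le>n. dL (\<alpha> i) (q j) \<le> R"
      unfolding R_def
    proof (rule LeastI_ex)
      have "dL (\<alpha> i) (q 0) \<le> Max ((\<lambda>i. dL (\<alpha> i) (q 0)) ` {..m})" if "i \<le> m" for i
        using that by (intro Max_ge) auto
      then show "\<exists>R. \<forall>i\<le>m. \<exists>j\<le>n. dL (\<alpha> i) (q j) \<le> R" using le0 by blast
    qed
    have "R \<le> 2 * D"
    proof (rule ccontr)
      assume "\<not> R \<le> 2 * D"
      then have R: "2 * D < R" by simp
      then have "\<not> (\<forall>i\<le>m. \<exists>j\<le>n. dL (\<alpha> i) (q j) \<le> R - 1)"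
        using not_less_Least[of "R - 1" "\<lambda>R. \<forall>i\<le>m. \<exists>j\<le>n. dL (\<alpha> i) (q j) \<le> R"] by (simp add: R_def)
      then have "\<exists>i0\<le>m. \<forall>j\<le>n. R - 1 < dL (\<alpha> i0) (q j)"
        unfolding not_le[symmetric] by blast
      then obtain i0 where i0: "i0 \<le> m" and far': "\<forall>j\<le>n. R - 1 < dL (\<alpha> i0) (q j)" by blast
      have far: "R \<le> dL (\<alpha> i0) (q j)" if "j \<le> n" for j using far'[rule_format, OF that] by linarith
      \<comment> \<open>Either \<open>\<alpha> i\<close> lies on \<open>q\<close> and the constant
        chain will do, or a geodesic of length at most \<open>R\<close> from
        \<open>\<alpha> i\<close> to \<open>q\<close> starts at distance at least
        \<open>2 * R\<close> from \<open>\<alpha> i0\<close>, so it cannot enter the ball.\<close>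
      have connect: "\<exists>j e g. j \<le> n \<and> e \<le> R \<and> chain L dL 1 e g \<and> g 0 = \<alpha> i \<and> g e = q j \<and>
          (\<forall>k\<le>e. R \<le> dL (\<alpha> i0) (g k))"
        if i: "i \<le> m" and "(\<exists>j\<le>n. \<alpha> i = q j) \<or> 2 * R \<le> dL (\<alpha> i0) (\<alpha> i)" for i
        using that(2)
      proof
        assume "\<exists>j\<le>n. \<alpha> i = q j"
        then obtain j where "j \<le> n" "\<alpha> i = q j" by blast
        then show ?thesis using far qL by (intro exI[of _ j] exI[of _ 0] exI[of _ "\<lambda>_. q j"]) (auto simp: chain_def)
      next
        assume away: "2 * R \<le> dL (\<alpha> i0) (\<alpha> i)"
        obtain j where j: "j \<le> n" "dL (\<alpha> i) (q j) \<le> R" using near i by blast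
        obtain g where g: "chain L dL 1 (dL (\<alpha> i) (q j)) g" "g 0 = \<alpha> i" "g (dL (\<alpha> i) (q j)) = q j"
          using mL.geodesic_chain[OF \<alpha>L[OF i] qL[OF j(1)]] by blast
        have "R \<le> dL (\<alpha> i0) (g k)" if k: "k \<le> dL (\<alpha> i) (q j)" for k
        proof -
          have X: "g k \<in> L" using g k by (auto simp: chain_def)
          have "dL (g 0) (g k) \<le> R" using mL.chain_dist[OF g(1), of 0 k] k j by simp
          then show ?thesis
            using away mL.tri[OF \<alpha>L[OF i0] X \<alpha>L[OF i]] mL.sym[OF X \<alpha>L[OF i]] g(2) by simp
        qed
        then show ?thesis
          using j g by (intro exI[of _ j] exI[of _ "dL (\<alpha> i) (q j)"] exI[of _ g]) simp
      qed
      \<comment> \<open>At index distance \<open>2 * A' * R\<close> on \<open>\<alpha>\<close>, the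
        bound \<open>dH_le_dL\<close> forces \<open>dL\<close> to be at least
        \<open>2 * R\<close>.\<close>
      define \<rho> where "\<rho> = 2 * A' * R"
      have R\<rho>: "R \<le> \<rho>" using A' by (simp add: \<rho>_def)
      have away: "2 * R \<le> dL (\<alpha> i0) (\<alpha> i)" if "i \<le> m" "i + \<rho> = i0 \<or> i0 + \<rho> = i" for i
      proof -
        have "dH (\<alpha> i0) (\<alpha> i) = \<rho>"
          using that(2)
        proof
          assume "i + \<rho> = i0"
          then show ?thesis using i0 \<alpha> mH.sym[OF \<alpha>H[OF i0] \<alpha>H[of i]] that(1) unfolding geodesic_H_def by auto
        next
          assume "i0 + \<rho> = i"
          then show ?thesis using \<alpha> that(1) unfolding geodesic_H_def by auto
        qed
        then have "A' * (2 * R) \<le> A' * dL (\<alpha> i0) (\<alpha> i)"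
          using dH_le_dL[OF \<alpha>H[OF i0] \<alpha>H[OF that(1)]] by (simp add: \<rho>_def A'_def mult_ac)
        then show ?thesis using A' by simp
      qed
      \<comment> \<open>The stretch is cut off at the ends of \<open>\<alpha>\<close>, by truncated
        subtraction on the left. An end that is cut off lies on \<open>q\<close>, which is the first
        case of \<open>connect\<close>.\<close>
      define i1 where "i1 = i0 - \<rho>"
      define i2 where "i2 = min (i0 + \<rho>) m"
      define m' where "m' = i2 - i1"
      have i12: "i1 \<le> i0" "i0 \<le> i2" "i2 \<le> m" using i0 by (auto simp: i1_def i2_def)
      have i1m: "i1 \<le> m" using i12 by simp
      have "i1 + \<rho> = i0 \<or> i1 = 0" by (auto simp: i1_def)
      then have "(\<exists>j\<le>n. \<alpha> i1 = q j) \<or> 2 * R \<le> dL (\<alpha> i0) (\<alpha> i1)"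
        using away[of i1] i12 ends by auto
      then obtain j1 e1 g1 where g1: "j1 \<le> n" "e1 \<le> R" "chain L dL 1 e1 g1" "g1 0 = \<alpha> i1" "g1 e1 = q j1"
          "\<forall>k\<le>e1. R \<le> dL (\<alpha> i0) (g1 k)"
        using connect[OF i1m] by blast
      have "i0 + \<rho> = i2 \<or> i2 = m" by (auto simp: i2_def)
      then have "(\<exists>j\<le>n. \<alpha> i2 = q j) \<or> 2 * R \<le> dL (\<alpha> i0) (\<alpha> i2)"
        using away[of i2] i12 ends by auto
      then obtain j2 e2 g2 where g2: "j2 \<le> n" "e2 \<le> R" "chain L dL 1 e2 g2" "g2 0 = \<alpha> i2" "g2 e2 = q j2"
          "\<forall>k\<le>e2. R \<le> dL (\<alpha> i0) (g2 k)"
        using connect[OF i12(3)] by blast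
      obtain h l where h: "chain L dL c l h" "h 0 = q j1" "h l = q j2" "h ` {..l} \<subseteq> q ` {..n}"
          "l = (if j1 \<le> j2 then j2 - j1 else j1 - j2)"
        by (rule mL.chain_between[OF qc g1(1) g2(1)])
      \<comment> \<open>The length of the bypass must be bounded by a multiple of \<open>m'\<close>,
        so \<open>R\<close> has to be compared with \<open>m'\<close>. If both ends are cut off, the
        distance from \<open>\<alpha> i0\<close> to the end \<open>q 0\<close> does this; otherwise
        the stretch contains a full side of length \<open>\<rho>\<close>.\<close>
      have Rm': "R \<le> B * m'"
      proof (cases "i0 \<le> \<rho> \<and> m \<le> i0 + \<rho>")
        case True
        have "R \<le> dL (\<alpha> i0) (\<alpha> 0)" using far[of 0] ends by simp
        also have "\<dots> \<le> B * i0" using geodesic_H_dist_L[OF \<alpha> i0, of 0] by (auto split: if_splits)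
        also have "\<dots> \<le> B * m'" using True i0 by (intro mult_le_mono2) (auto simp: m'_def i1_def i2_def)
        finally show ?thesis .
      next
        case False
        then have "\<rho> \<le> m'" using i0 by (auto simp: m'_def i1_def i2_def)
        then have "R \<le> 1 * m'" using R\<rho> by simp
        also have "\<dots> \<le> B * m'" using pos by (intro mult_le_mono1)
        finally show ?thesis .
      qed
      \<comment> \<open>Positivity of \<open>m'\<close> lets the additive \<open>K\<close> be
        absorbed into \<open>K * m'\<close>.\<close>
      then have m'1: "1 \<le> m'" using R by (cases m') auto
      have len: "e1 + (l + e2) \<le> C * m'"
      proof -
        have X: "\<alpha> i1 \<in> L" "\<alpha> i2 \<in> L" "q j1 \<in> L" "q j2 \<in> L" using \<alpha>L qL i12 g1 g2 by auto
        have a: "dL (\<alpha> i1) (q j1) \<le> R" using mL.chain_dist[OF g1(3), of 0 e1] g1 by simp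
        have b: "dL (\<alpha> i2) (q j2) \<le> R" using mL.chain_dist[OF g2(3), of 0 e2] g2 by simp
        have "dL (\<alpha> i1) (\<alpha> i2) \<le> B * m'"
          using geodesic_H_dist_L[OF \<alpha>, of i1 i2] i12 by (simp add: m'_def)
        then have "dL (q j1) (q j2) \<le> 2 * R + B * m'"
          using mL.tri[OF X(3,1,4)] mL.tri[OF X(1,2,4)] mL.sym[OF X(1,3)] a b by linarith
        then have d: "dL (q j1) (q j2) \<le> 3 * B * m'" using Rm' by simp
        have "l \<le> K * dL (q j1) (q j2) + K"
          using ql[OF g1(1) g2(1)] ql[OF g2(1) g1(1)] mL.sym[OF X(3,4)] h(5) by (cases "j1 \<le> j2") simp_all
        also have "\<dots> \<le> K * (3 * B * m') + K * m'" by (intro add_mono mult_le_mono2 d) (use m'1 in simp)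
        finally have "e1 + (l + e2) \<le> 2 * (B * m') + (K * (3 * B * m') + K * m')"
          using g1(2) g2(2) Rm' by linarith
        then show ?thesis by (simp add: C_def algebra_simps)
      qed
      define g2' where "g2' = (\<lambda>k. g2 (e2 - k))"
      have c1: "chain L dL c e1 g1" "chain L dL c e2 g2'"
        unfolding g2'_def using chain_mono[OF g1(3)] mL.chain_rev[OF chain_mono[OF g2(3)]] by (simp_all add: c_def)
      define p where "p = glue e1 g1 (glue l h g2')"
      have hg: "h l = g2' 0" using h g2 by (simp add: g2'_def)
      have gh: "g1 e1 = glue l h g2' 0" using glue_simps(3)[of h l g2', OF hg] g1 h by simp
      have p: "chain L dL c (e1 + (l + e2)) p"
        unfolding p_def by (intro chain_glue c1 h hg gh)
      have p0: "p 0 = \<alpha> i1" using glue_simps(3)[of g1 e1 "glue l h g2'", OF gh] g1 by (simp add: p_def)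
      have pe: "p (e1 + (l + e2)) = \<alpha> i2"
        using glue_simps(2)[of g1 e1 "glue l h g2'" "l + e2", OF gh] glue_simps(2)[of h l g2' e2, OF hg] g2 by (simp add: p_def g2'_def)
      have avoid: "R \<le> dL (\<alpha> i0) (p k)" if "k \<le> e1 + (l + e2)" for k
      proof -
        have "p k \<in> g1 ` {..e1} \<union> (h ` {..l} \<union> g2' ` {..e2})"
        proof -
          have "p k \<in> p ` {..e1 + (l + e2)}" using that by simp
          also have "\<dots> \<subseteq> g1 ` {..e1} \<union> glue l h g2' ` {..l + e2}" unfolding p_def by (rule glue_image)
          also have "\<dots> \<subseteq> g1 ` {..e1} \<union> (h ` {..l} \<union> g2' ` {..e2})"
            by (intro Un_mono order.refl glue_image)
          finally show ?thesis .
        qed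
        then show ?thesis using g1(6) g2(6) h(4) far by (auto simp: g2'_def)
      qed
      have "geodesic_H m' (\<lambda>j. \<alpha> (i1 + j))"
        using geodesic_H_shift[OF \<alpha>, of i1 m'] i12 by (simp add: m'_def)
      then have "\<exists>i\<le>m'. \<exists>k\<le>e1 + (l + e2). i \<le> (i0 - i1) + m' div N \<and> (i0 - i1) \<le> i + m' div N \<and>
          dL (\<alpha> (i1 + i)) (p k) \<le> D"
        using p0 pe i12 len by (intro D[OF p]) (auto simp: m'_def)
      then obtain i k where ik: "i \<le> m'" "k \<le> e1 + (l + e2)" "i \<le> (i0 - i1) + m' div N" "(i0 - i1) \<le> i + m' div N"
        "dL (\<alpha> (i1 + i)) (p k) \<le> D" by blast
      have im: "i1 + i \<le> m" using ik i12 by (simp add: m'_def)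
      have "dL (\<alpha> i0) (\<alpha> (i1 + i)) \<le> B * (if i0 \<le> i1 + i then (i1 + i) - i0 else i0 - (i1 + i))"
        by (rule geodesic_H_dist_L[OF \<alpha> i0 im])
      also have "\<dots> \<le> B * (m' div N)" using ik i12 by (intro mult_le_mono2) auto
      finally have "dL (\<alpha> i0) (\<alpha> (i1 + i)) \<le> B * (m' div N)" .
      moreover have "2 * (B * (m' div N)) \<le> R"
      proof -
        have "N * (m' div N) \<le> m'" by simp
        also have "m' \<le> 2 * \<rho>" by (auto simp: m'_def i1_def i2_def)
        finally have "4 * A' * (2 * (B * (m' div N))) \<le> 4 * A' * R" by (simp add: N_def \<rho>_def mult_ac)
        then show ?thesis using A' by simp
      qed
      moreover have "p k \<in> L" using p ik by (auto simp: chain_def)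
      then have "dL (\<alpha> i0) (p k) \<le> dL (\<alpha> i0) (\<alpha> (i1 + i)) + dL (\<alpha> (i1 + i)) (p k)"
        using mL.tri[OF \<alpha>L[OF i0] \<alpha>L[OF im]] by blast
      \<comment> \<open>The point \<open>p k\<close> would be within \<open>R / 2 + D < R\<close> of
        \<open>\<alpha> i0\<close>.\<close>
      ultimately show False using avoid[OF ik(2)] ik(5) R by linarith
    qed
    then show "\<forall>i\<le>m. \<exists>j\<le>n. dL (\<alpha> i) (q j) \<le> 2 * D" using near by (meson le_trans)
  qed
qed

text \<open>The indices on \<open>q\<close> of points near successive \<open>\<alpha> i\<close> have
  bounded jumps and run from 0 to \<open>n\<close>, so they come within a bounded distance of every
  index of \<open>q\<close>.\<close>

lemma quasigeod_near_geodesic: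
  obtains R where "\<And>n q m \<alpha>. quasigeod L dL K n q \<Longrightarrow> geodesic_H m \<alpha> \<Longrightarrow> \<alpha> 0 = q 0 \<Longrightarrow> \<alpha> m = q n \<Longrightarrow>
     \<forall>j\<le>n. \<exists>i\<le>m. dL (q j) (\<alpha> i) \<le> R"
proof -
  obtain R where R: "\<And>n q m \<alpha>. quasigeod L dL K n q \<Longrightarrow> geodesic_H m \<alpha> \<Longrightarrow> \<alpha> 0 = q 0 \<Longrightarrow> \<alpha> m = q n \<Longrightarrow>
     \<forall>i\<le>m. \<exists>j\<le>n. dL (\<alpha> i) (q j) \<le> R"
    using geodesic_near_quasigeod[of K] by blast
  define E where "E = K * (2 * R + B) + K"
  show ?thesis
  proof (rule that[of "K * E + K + R"])
    fix n q m \<alpha>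
    assume q: "quasigeod L dL K n q" and \<alpha>: "geodesic_H m \<alpha>" and ends: "\<alpha> 0 = q 0" "\<alpha> m = q n"
    have \<alpha>L: "\<alpha> i \<in> L" if "i \<le> m" for i using \<alpha> that HL by (auto simp: geodesic_H_def)
    have qL: "q j \<in> L" if "j \<le> n" for j using q that by (auto simp: quasigeod_def)
    have ql: "j - i \<le> K * dL (q i) (q j) + K" if "i \<le> n" "j \<le> n" for i j
      using q that unfolding quasigeod_def by (cases "i \<le> j") auto
    have qu: "dL (q i) (q j) \<le> K * (j - i) + K" if "i \<le> j" "j \<le> n" for i j
      using q that unfolding quasigeod_def by blast
    obtain f0 where f0: "\<And>i. i \<le> m \<Longrightarrow> f0 i \<le> n \<and> dL (\<alpha> i) (q (f0 i)) \<le> R"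
      using R[OF q \<alpha> ends] by metis
    show "\<forall>j\<le>n. \<exists>i\<le>m. dL (q j) (\<alpha> i) \<le> K * E + K + R"
    proof (cases "m = 0")
      \<comment> \<open>A single index cannot be sent to both 0 and \<open>n\<close>. Here
        \<open>q\<close> is closed, however, and a closed quasigeodesic has at most \<open>K\<close>
        steps.\<close>
      case True
      then have "q 0 = q n" using ends by simp
      then have "dL (q 0) (q n) = 0" using mL.zero_iff qL by simp
      then have n: "n \<le> K" using ql[of 0 n] by simp
      have "dL (q j) (\<alpha> 0) \<le> K * E + K + R" if j: "j \<le> n" for j
      proof -
        have KE: "K \<le> E" by (simp add: E_def)
        have "dL (q j) (\<alpha> 0) = dL (q 0) (q j)" using mL.sym qL j ends by simp
        also have "\<dots> \<le> K * j + K" using qu[of 0 j] j by simp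
        also have "\<dots> \<le> K * E + K" using j n KE by (intro add_right_mono mult_le_mono2) simp
        finally show ?thesis by simp
      qed
      then show ?thesis by blast
    next
      case False
      \<comment> \<open>The values at the ends are imposed, which is consistent as
        \<open>\<alpha>\<close> and \<open>q\<close> share their ends; otherwise the range of
        \<open>f\<close> might miss the beginning and the end of \<open>q\<close>.\<close>
      define f where "f = (\<lambda>i. if i = 0 then 0 else if i = m then n else f0 i)"
      have f: "f i \<le> n" "dL (\<alpha> i) (q (f i)) \<le> R" if "i \<le> m" for i
      proof -
        have "dL (\<alpha> 0) (q 0) = 0" "dL (\<alpha> m) (q n) = 0" using mL.zero_iff \<alpha>L qL ends by simp_all
        then show "f i \<le> n" "dL (\<alpha> i) (q (f i)) \<le> R" using f0[OF that] by (auto simp: f_def)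
      qed
      have step: "f (Suc i) \<le> f i + E \<and> f i \<le> f (Suc i) + E" if "Suc i \<le> m" for i
      proof -
        have X: "\<alpha> i \<in> L" "\<alpha> (Suc i) \<in> L" "q (f i) \<in> L" "q (f (Suc i)) \<in> L"
          using that \<alpha>L qL f by auto
        have "dL (\<alpha> i) (\<alpha> (Suc i)) \<le> B" using geodesic_H_dist_L[OF \<alpha>, of i "Suc i"] that by simp
        then have le: "dL (q (f i)) (q (f (Suc i))) \<le> 2 * R + B"
          using mL.tri[OF X(3,1,4)] mL.tri[OF X(1,2,4)] mL.sym[OF X(1,3)] f(2)[of i] f(2)[of "Suc i"] that by simp
        have "K * dL (q (f i)) (q (f (Suc i))) + K \<le> E"
          unfolding E_def by (intro add_right_mono mult_le_mono2 le)
        moreover have "f (Suc i) - f i \<le> K * dL (q (f i)) (q (f (Suc i))) + K"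
          "f i - f (Suc i) \<le> K * dL (q (f i)) (q (f (Suc i))) + K"
          using ql[OF f(1) f(1), of i "Suc i"] ql[OF f(1) f(1), of "Suc i" i] that mL.sym[OF X(3,4)] by simp_all
        ultimately show ?thesis by linarith
      qed
      have "\<exists>i\<le>m. dL (q j) (\<alpha> i) \<le> K * E + K + R" if j: "j \<le> n" for j
      proof -
        obtain i where i: "i \<le> m" "f i \<le> j + E" "j \<le> f i + E"
          using coarse_connected[of 0 m f E j] step j False by (auto simp: f_def)
        have X: "q j \<in> L" "q (f i) \<in> L" "\<alpha> i \<in> L" using qL f \<alpha>L i j by auto
        have "dL (q j) (q (f i)) \<le> K * E + K"
        proof (cases "j \<le> f i")
          case True
          have "dL (q j) (q (f i)) \<le> K * (f i - j) + K" using qu True f i by simp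
          also have "\<dots> \<le> K * E + K" using i by (intro add_right_mono mult_le_mono2) simp
          finally show ?thesis .
        next
          case False
          have "dL (q j) (q (f i)) \<le> K * (j - f i) + K" using qu[of "f i" j] mL.sym[OF X(1,2)] False j by simp
          also have "\<dots> \<le> K * E + K" using i by (intro add_right_mono mult_le_mono2) simp
          finally show ?thesis .
        qed
        then have "dL (q j) (\<alpha> i) \<le> K * E + K + R"
          using mL.tri[OF X] mL.sym[OF X(2,3)] f(2)[OF i(1)] by simp
        then show ?thesis using i by blast
      qed
      then show ?thesis by blast
    qed
  qed
qed

text \<open>Two quasigeodesics with common ends in \<open>H\<close> are compared through a geodesic
  of \<open>H\<close> with the same ends.\<close>

theorem morse_L: "morse H L dL"
  unfolding morse_def
proof
  fix K
  obtain R1 where R1: "\<And>n q m \<alpha>. quasigeod L dL K n q \<Longrightarrow> geodesic_H m \<alpha> \<Longrightarrow> \<alpha> 0 = q 0 \<Longrightarrow> \<alpha> m = q n \<Longrightarrow>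
     \<forall>i\<le>m. \<exists>j\<le>n. dL (\<alpha> i) (q j) \<le> R1"
    using geodesic_near_quasigeod[of K] by blast
  obtain R2 where R2: "\<And>n q m \<alpha>. quasigeod L dL K n q \<Longrightarrow> geodesic_H m \<alpha> \<Longrightarrow> \<alpha> 0 = q 0 \<Longrightarrow> \<alpha> m = q n \<Longrightarrow>
     \<forall>j\<le>n. \<exists>i\<le>m. dL (q j) (\<alpha> i) \<le> R2"
    using quasigeod_near_geodesic[of K] by blast
  show "\<exists>D. \<forall>n q n' q'. quasigeod L dL K n q \<longrightarrow> quasigeod L dL K n' q' \<longrightarrow>
     q 0 \<in> H \<longrightarrow> q n \<in> H \<longrightarrow> q' 0 = q 0 \<longrightarrow> q' n' = q n \<longrightarrow> (\<forall>i\<le>n. \<exists>j\<le>n'. dL (q i) (q' j) \<le> D)"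
  proof (rule exI[of _ "R2 + R1"], intro allI impI)
    fix n q n' q' i
    assume q: "quasigeod L dL K n q" and q': "quasigeod L dL K n' q'"
      and H: "q 0 \<in> H" "q n \<in> H" and ends: "q' 0 = q 0" "q' n' = q n" and i: "i \<le> n"
    obtain \<alpha> where \<alpha>: "chain H dH 1 (dH (q 0) (q n)) \<alpha>" "\<alpha> 0 = q 0" "\<alpha> (dH (q 0) (q n)) = q n"
        "\<And>i j. i \<le> j \<Longrightarrow> j \<le> dH (q 0) (q n) \<Longrightarrow> dH (\<alpha> i) (\<alpha> j) = j - i"
      using mH.geodesic[OF H] by blast
    have g: "geodesic_H (dH (q 0) (q n)) \<alpha>" using \<alpha> by (auto simp: geodesic_H_def chain_def)
    obtain k where k: "k \<le> dH (q 0) (q n)" "dL (q i) (\<alpha> k) \<le> R2" using R2[OF q g] \<alpha> i by auto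
    obtain j where j: "j \<le> n'" "dL (\<alpha> k) (q' j) \<le> R1" using R1[OF q' g] \<alpha> ends k by auto
    have "q i \<in> L" "\<alpha> k \<in> L" "q' j \<in> L"
      using q q' g i j k HL by (auto simp: quasigeod_def geodesic_H_def)
    then have "dL (q i) (q' j) \<le> R2 + R1" using mL.tri[of "q i" "\<alpha> k" "q' j"] j k by linarith
    then show "\<exists>j\<le>n'. dL (q i) (q' j) \<le> R2 + R1" using j by blast
  qed
qed

end

subsection \<open>Word metrics\<close>

lemma (in group) word_closed: "set ws \<subseteq> carrier G \<Longrightarrow> foldr (\<otimes>) ws \<one> \<in> carrier G"
  by (induction ws) auto

lemma (in group) word_append:
  "set ws \<subseteq> carrier G \<Longrightarrow> set vs \<subseteq> carrier G \<Longrightarrow>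
     foldr (\<otimes>) (ws @ vs) \<one> = foldr (\<otimes>) ws \<one> \<otimes> foldr (\<otimes>) vs \<one>"
  by (induction ws) (auto simp: word_closed m_assoc)

lemma (in group) word_inv:
  "set ws \<subseteq> carrier G \<Longrightarrow> foldr (\<otimes>) (rev (map (m_inv G) ws)) \<one> = inv (foldr (\<otimes>) ws \<one>)"
proof (induction ws)
  case (Cons w ws)
  have "set (rev (map (m_inv G) ws)) \<subseteq> carrier G" using Cons.prems by auto
  moreover have "set [inv w] \<subseteq> carrier G" using Cons.prems by simp
  ultimately show ?case
    using Cons word_append[of "rev (map (m_inv G) ws)" "[inv w]"] by (simp add: word_closed inv_mult_group)
qed simp

locale fg_group = group G for G :: "('a, 'b) monoid_scheme" (structure) +
  fixes S :: "'a set"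
  assumes generating: "finite_generating_set G S"
begin

definition letters :: "'a set" where
  "letters = S \<union> m_inv G ` S"

text \<open>Keeps the values of \<open>word_dist\<close> in \<open>nat\<close>, as
  \<open>geodesic_nat_metric\<close> demands.\<close>

definition wdist :: "'a \<Rightarrow> 'a \<Rightarrow> nat" where
  "wdist x y = word_length G S (inv x \<otimes> y)"

lemma letters_carrier: "letters \<subseteq> carrier G"
  using generating by (auto simp: letters_def finite_generating_set_def)

lemma letters_inv: "w \<in> letters \<Longrightarrow> inv w \<in> letters"
  using generating by (auto simp: letters_def finite_generating_set_def subset_iff)

lemma word_exists:
  assumes "g \<in> carrier G"
  shows "\<exists>ws. set ws \<subseteq> letters \<and> foldr (\<otimes>) ws \<one> = g"
proof -
  have "g \<in> generate G S" using assms generating by (simp add: finite_generating_set_def)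
  then show ?thesis
  proof induction
    case one
    show ?case by (intro exI[of _ "[]"]) simp
  next
    case (incl h)
    then have "h \<in> letters" by (simp add: letters_def)
    then show ?case using letters_carrier by (intro exI[of _ "[h]"]) auto
  next
    case (inv h)
    then have "inv h \<in> letters" by (simp add: letters_def)
    then show ?case using letters_carrier by (intro exI[of _ "[inv h]"]) auto
  next
    case (eng h k)
    then obtain ws vs where "set ws \<subseteq> letters" "foldr (\<otimes>) ws \<one> = h"
      "set vs \<subseteq> letters" "foldr (\<otimes>) vs \<one> = k" by blast
    then show ?case using letters_carrier word_append[of ws vs]
      by (intro exI[of _ "ws @ vs"]) (metis Un_least order_trans set_append)
  qed
qed

lemma length_word:
  assumes "g \<in> carrier G"
  obtains ws where "length ws = word_length G S g" "set ws \<subseteq> letters" "foldr (\<otimes>) ws \<one> = g"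
proof -
  have "\<exists>n ws. length ws = n \<and> set ws \<subseteq> S \<union> m_inv G ` S \<and> foldr (\<otimes>) ws \<one> = g"
    using word_exists[OF assms] by (auto simp: letters_def)
  from LeastI_ex[OF this] show ?thesis using that by (auto simp: letters_def word_length_def)
qed

lemma word_length_le: "set ws \<subseteq> letters \<Longrightarrow> word_length G S (foldr (\<otimes>) ws \<one>) \<le> length ws"
  unfolding word_length_def letters_def by (rule Least_le) blast

lemma word_length_mult:
  assumes "g \<in> carrier G" "h \<in> carrier G"
  shows "word_length G S (g \<otimes> h) \<le> word_length G S g + word_length G S h"
proof -
  obtain ws where ws: "length ws = word_length G S g" "set ws \<subseteq> letters" "foldr (\<otimes>) ws \<one> = g"
    using length_word assms by blast
  obtain vs where vs: "length vs = word_length G S h" "set vs \<subseteq> letters" "foldr (\<otimes>) vs \<one> = h"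
    using length_word assms by blast
  have "set ws \<subseteq> carrier G" "set vs \<subseteq> carrier G" using ws vs letters_carrier by auto
  then have "foldr (\<otimes>) (ws @ vs) \<one> = g \<otimes> h" using word_append ws vs by metis
  then show ?thesis using word_length_le[of "ws @ vs"] ws vs by simp
qed

lemma word_length_inv:
  assumes "g \<in> carrier G"
  shows "word_length G S (inv g) = word_length G S g"
proof -
  have le: "word_length G S (inv g) \<le> word_length G S g" if g: "g \<in> carrier G" for g
  proof -
    obtain ws where ws: "length ws = word_length G S g" "set ws \<subseteq> letters" "foldr (\<otimes>) ws \<one> = g"
      using length_word g by blast
    have "set ws \<subseteq> carrier G" using ws letters_carrier by auto
    then have "foldr (\<otimes>) (rev (map (m_inv G) ws)) \<one> = inv g" using word_inv ws by simp
    moreover have "set (rev (map (m_inv G) ws)) \<subseteq> letters" using ws letters_inv by auto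
    ultimately show ?thesis using word_length_le[of "rev (map (m_inv G) ws)"] ws by simp
  qed
  show ?thesis using le[OF assms] le[of "inv g"] assms by simp
qed

lemma word_length_eq_0_iff: "g \<in> carrier G \<Longrightarrow> word_length G S g = 0 \<longleftrightarrow> g = \<one>"
  using word_length_le[of "[]"] by (auto elim: length_word)

text \<open>A ball consists of the values of the finitely many words of bounded length over a finite
  alphabet.\<close>

lemma finite_word_ball: "finite {g \<in> carrier G. word_length G S g \<le> n}"
proof (rule finite_subset)
  have "finite letters" using generating by (simp add: letters_def finite_generating_set_def)
  then show "finite ((\<lambda>ws. foldr (\<otimes>) ws \<one>) ` {ws. set ws \<subseteq> letters \<and> length ws \<le> n})"
    by (intro finite_imageI finite_lists_length_le)
  show "{g \<in> carrier G. word_length G S g \<le> n} \<subseteq>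
      (\<lambda>ws. foldr (\<otimes>) ws \<one>) ` {ws. set ws \<subseteq> letters \<and> length ws \<le> n}"
    by (auto elim!: length_word intro!: image_eqI)
qed

sublocale geodesic_nat_metric "carrier G" wdist
proof
  fix x y assume x: "x \<in> carrier G" and y: "y \<in> carrier G"
  have "inv x \<otimes> y = \<one> \<longleftrightarrow> x = y"
    using x y by (metis inv_closed inv_equality inv_inv l_inv)
  then show "wdist x y = 0 \<longleftrightarrow> x = y" using x y by (simp add: wdist_def word_length_eq_0_iff)
  have "inv (inv x \<otimes> y) = inv y \<otimes> x" using x y by (simp add: inv_mult_group)
  then show "wdist x y = wdist y x" unfolding wdist_def using word_length_inv[of "inv x \<otimes> y"] x y by simp
  show "\<exists>p. chain (carrier G) wdist 1 (wdist x y) p \<and> p 0 = x \<and> p (wdist x y) = y"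
  proof -
    obtain ws where ws: "length ws = wdist x y" "set ws \<subseteq> letters" "foldr (\<otimes>) ws \<one> = inv x \<otimes> y"
      using length_word[of "inv x \<otimes> y"] x y unfolding wdist_def by auto
    \<comment> \<open>The prefixes of a shortest word for \<open>inv x \<otimes> y\<close>,
      translated by \<open>x\<close>, trace a geodesic from \<open>x\<close> to
      \<open>y\<close>.\<close>
    define p where "p = (\<lambda>i. x \<otimes> foldr (\<otimes>) (take i ws) \<one>)"
    have wc: "set ws \<subseteq> carrier G" using ws letters_carrier by auto
    have tc: "foldr (\<otimes>) (take i ws) \<one> \<in> carrier G" for i
      using wc by (meson set_take_subset order_trans word_closed)
    have "wdist (p i) (p (Suc i)) \<le> 1" if i: "i < wdist x y" for i
    proof -
      have w: "ws ! i \<in> letters" using ws i by (simp add: subset_iff)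
      then have w': "ws ! i \<in> carrier G" using letters_carrier by auto
      have "foldr (\<otimes>) (take (Suc i) ws) \<one> = foldr (\<otimes>) (take i ws) \<one> \<otimes> ws ! i"
        using i ws wc w' word_append[of "take i ws" "[ws ! i]"] set_take_subset[of i ws]
        by (simp add: take_Suc_conv_app_nth)
      then have "p (Suc i) = p i \<otimes> ws ! i" using x tc w' by (simp add: p_def m_assoc)
      moreover have "p i \<in> carrier G" using x tc by (simp add: p_def)
      ultimately have "inv (p i) \<otimes> p (Suc i) = foldr (\<otimes>) [ws ! i] \<one>"
        using w' by (simp add: m_assoc[symmetric])
      then show ?thesis using word_length_le[of "[ws ! i]"] w by (simp add: wdist_def)
    qed
    moreover have "p 0 = x" "p (wdist x y) = y" using x y ws by (simp_all add: p_def m_assoc[symmetric])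
    moreover have "p i \<in> carrier G" for i using x tc by (simp add: p_def)
    ultimately show ?thesis by (intro exI[of _ p]) (simp add: chain_def)
  qed
  fix z assume z: "z \<in> carrier G"
  have "inv x \<otimes> y \<otimes> (inv y \<otimes> z) = inv x \<otimes> (y \<otimes> inv y \<otimes> z)" using x y z by (metis m_assoc m_closed inv_closed)
  also have "\<dots> = inv x \<otimes> z" using x y z by simp
  finally show "wdist x z \<le> wdist x y + wdist y z"
    using word_length_mult[of "inv x \<otimes> y" "inv y \<otimes> z"] x y z by (simp add: wdist_def)
qed

end

section \<open>Word metrics of a group and of its subgroups\<close>

lemma fg_group_subgroup:
  assumes "group G" "subgroup K G" "finite_generating_set (G\<lparr>carrier := K\<rparr>) T"
  shows "fg_group (G\<lparr>carrier := K\<rparr>) T"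
  unfolding fg_group_def fg_group_axioms_def
  using assms group.subgroup_imp_group by blast

lemma (in fg_group) subgroup_wdist:
  assumes "subgroup K G" "finite_generating_set (G\<lparr>carrier := K\<rparr>) T" "x \<in> K" "y \<in> K"
  shows "fg_group.wdist (G\<lparr>carrier := K\<rparr>) T x y = word_length (G\<lparr>carrier := K\<rparr>) T (inv x \<otimes> y)"
    "inv x \<otimes> y \<in> K"
proof -
  interpret K: fg_group "G\<lparr>carrier := K\<rparr>" T by (rule fg_group_subgroup[OF is_group assms(1,2)])
  show "K.wdist x y = word_length (G\<lparr>carrier := K\<rparr>) T (inv x \<otimes> y)"
    using m_inv_consistent[OF assms(1,3)] by (simp add: K.wdist_def)
  show "inv x \<otimes> y \<in> K" using assms by (simp add: subgroup.m_closed subgroup.m_inv_closed)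
qed

text \<open>Both distances depend only on \<open>inv x \<otimes> y\<close>, which ranges over a
  finite ball of \<open>G\<close>. A maximum over this ball exists however distorted
  \<open>K\<close> is.\<close>

lemma (in fg_group) subgroup_wdist_proper:
  assumes K: "subgroup K G" and T: "finite_generating_set (G\<lparr>carrier := K\<rparr>) T"
  shows "\<exists>D'. \<forall>x\<in>K. \<forall>y\<in>K. wdist x y \<le> D \<longrightarrow> fg_group.wdist (G\<lparr>carrier := K\<rparr>) T x y \<le> D'"
proof -
  define F where "F = {g \<in> carrier G. word_length G S g \<le> D}"
  have "finite F" unfolding F_def by (rule finite_word_ball)
  show ?thesis
  proof (intro exI ballI impI)
    fix x y assume xy: "x \<in> K" "y \<in> K" "wdist x y \<le> D"
    have "inv x \<otimes> y \<in> F"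
      using xy subgroup_wdist(2)[OF K T xy(1,2)] subgroup.subset[OF K] by (auto simp: F_def wdist_def)
    \<comment> \<open>Elements of \<open>F\<close> outside \<open>K\<close> have a meaningless word
      length over \<open>T\<close>, but they can only increase the maximum.\<close>
    then show "fg_group.wdist (G\<lparr>carrier := K\<rparr>) T x y \<le> Max (word_length (G\<lparr>carrier := K\<rparr>) T ` F)"
      using subgroup_wdist(1)[OF K T xy(1,2)] \<open>finite F\<close> by simp
  qed
qed

text \<open>Only finitely many elements of \<open>K\<close> have word length at most 1, which bounds
  unit steps; the bound then adds up along a geodesic of \<open>K\<close>.\<close>

lemma (in fg_group) subgroup_wdist_upper:
  assumes K: "subgroup K G" and T: "finite_generating_set (G\<lparr>carrier := K\<rparr>) T"
  shows "\<exists>M\<ge>1. \<forall>x\<in>K. \<forall>y\<in>K. wdist x y \<le> M * fg_group.wdist (G\<lparr>carrier := K\<rparr>) T x y"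
proof -
  interpret K: fg_group "G\<lparr>carrier := K\<rparr>" T by (rule fg_group_subgroup[OF is_group K T])
  define F where "F = {g \<in> K. word_length (G\<lparr>carrier := K\<rparr>) T g \<le> 1}"
  have F: "finite F" unfolding F_def using K.finite_word_ball[of 1] by simp
  define M where "M = Suc (Max (word_length G S ` F))"
  have step: "wdist x y \<le> M" if xy: "x \<in> K" "y \<in> K" "K.wdist x y \<le> 1" for x y
  proof -
    have "inv x \<otimes> y \<in> F" using xy subgroup_wdist[OF K T xy(1,2)] by (auto simp: F_def)
    then have "word_length G S (inv x \<otimes> y) \<le> Max (word_length G S ` F)" using F by simp
    then show ?thesis by (simp add: M_def wdist_def)
  qed
  have "wdist x y \<le> M * K.wdist x y" if xy: "x \<in> K" "y \<in> K" for x y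
  proof -
    obtain p where p: "chain K K.wdist 1 (K.wdist x y) p" "p 0 = x" "p (K.wdist x y) = y"
      using K.geodesic_chain[of x y] xy by auto
    have "chain (carrier G) wdist M (K.wdist x y) p"
      using p(1) step subgroup.subset[OF K] unfolding chain_def by auto
    from chain_dist[OF this, of 0 "K.wdist x y"] show ?thesis using p by simp
  qed
  then show ?thesis by (intro exI[of _ M]) (simp add: M_def)
qed

subsection \<open>Cayley graphs\<close>

lemma quasigeod_mono:
  assumes "quasigeod X d K n q" "K \<le> K'"
  shows "quasigeod X d K' n q"
proof -
  have "x \<le> K' * y + K'" if "x \<le> K * y + K" for x y
    using that add_mono[OF mult_le_mono1[OF assms(2)] assms(2)] by (rule le_trans)
  then show ?thesis using assms(1) unfolding quasigeod_def by blast
qed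

lemma supp_vertex [simp]: "supp (vertex u) = {u}"
  by (auto simp: supp_def vertex_def)

context fg_group
begin

section \<open>Points of the Cayley graph compared with vertices\<close>

lemma cayley_adj_wdist:
  assumes "cayley_adj G S u v"
  shows "wdist u v \<le> 1"
proof -
  have uv: "u \<in> carrier G" "v \<in> carrier G" using assms by (auto simp: cayley_adj_def)
  obtain s where s: "s \<in> S" "v = u \<otimes> s \<or> u = v \<otimes> s" using assms by (auto simp: cayley_adj_def)
  then have sc: "s \<in> carrier G" and sl: "s \<in> letters" using letters_carrier by (auto simp: letters_def)
  have "inv u \<otimes> v = foldr (\<otimes>) [s] \<one> \<or> inv u \<otimes> v = foldr (\<otimes>) [inv s] \<one>"
    using s(2) uv sc by (auto simp: m_assoc[symmetric] inv_mult_group) (simp add: m_assoc)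
  then show ?thesis
    using word_length_le[of "[s]"] word_length_le[of "[inv s]"] sl letters_inv[OF sl] by (auto simp: wdist_def)
qed

lemma cayley_graph_point:
  assumes "p \<in> cayley_graph G S"
  shows "supp p \<noteq> {}" "finite (supp p)" "supp p \<subseteq> carrier G"
    "\<And>x. 0 \<le> p x" "\<And>x. p x \<le> 1"
    "\<And>u v. u \<in> supp p \<Longrightarrow> v \<in> supp p \<Longrightarrow> wdist u v \<le> 1"
proof -
  have "supp p \<noteq> {} \<and> finite (supp p) \<and> supp p \<subseteq> carrier G \<and> (\<forall>x. 0 \<le> p x \<and> p x \<le> 1) \<and>
    (\<forall>u\<in>supp p. \<forall>v\<in>supp p. wdist u v \<le> 1)"
    using assms unfolding cayley_graph_def
  proof
    assume "p \<in> vertex ` carrier G"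
    then obtain u where "u \<in> carrier G" "p = vertex u" by auto
    moreover from this have "0 \<le> p x \<and> p x \<le> 1" for x by (simp add: vertex_def)
    ultimately show ?thesis using zero_iff[of u u] by simp
  next
    assume "p \<in> {(\<lambda>x. (1 - t) * vertex u x + t * vertex v x) | t u v. t \<in> {0..1} \<and> cayley_adj G S u v}"
    then obtain t u v where t: "0 \<le> t" "t \<le> 1" and adj: "cayley_adj G S u v"
      and p: "p = (\<lambda>x. (1 - t) * vertex u x + t * vertex v x)" by auto
    have uv: "u \<in> carrier G" "v \<in> carrier G" "u \<noteq> v" using adj by (auto simp: cayley_adj_def)
    have s: "supp p \<subseteq> {u, v}" by (auto simp: supp_def p vertex_def)
    have "p u = 1 - t" "p v = t" using uv by (auto simp: p vertex_def)
    then have "u \<in> supp p \<or> v \<in> supp p" by (auto simp: supp_def)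
    moreover have "0 \<le> p x \<and> p x \<le> 1" for x using t uv by (auto simp: p vertex_def)
    moreover have "wdist a b \<le> 1" if "a \<in> {u, v}" "b \<in> {u, v}" for a b
      using that cayley_adj_wdist[OF adj] sym[OF uv(1,2)] zero_iff[of u u] zero_iff[of v v] uv by auto
    moreover have "supp p \<subseteq> carrier G" using s uv by auto
    moreover have "finite (supp p)" using finite_subset[OF s] by simp
    ultimately show ?thesis using s by (metis empty_iff subsetD)
  qed
  then show "supp p \<noteq> {}" "finite (supp p)" "supp p \<subseteq> carrier G"
    "\<And>x. 0 \<le> p x" "\<And>x. p x \<le> 1"
    "\<And>u v. u \<in> supp p \<Longrightarrow> v \<in> supp p \<Longrightarrow> wdist u v \<le> 1" by auto
qed

text \<open>On a common edge both distances lie between 0 and 1. Otherwise the minimum is attained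
  at some ends \<open>a\<close> and \<open>b\<close>: the parts inside the two edges contribute at
  most 2, and replacing \<open>a\<close>, \<open>b\<close> by \<open>u\<close>, \<open>v\<close>
  changes the word distance by at most 2.\<close>

lemma cayley_dist_wdist:
  assumes p: "p \<in> cayley_graph G S" and q: "q \<in> cayley_graph G S"
    and u: "u \<in> supp p" and v: "v \<in> supp q"
  shows "\<bar>cayley_dist G S p q - real (wdist u v)\<bar> \<le> 4"
proof (cases "\<exists>a b. cayley_adj G S a b \<and> supp p \<union> supp q \<subseteq> {a, b}")
  case True
  then obtain a b where ab: "cayley_adj G S a b" "supp p \<union> supp q \<subseteq> {a, b}" by blast
  have c: "a \<in> carrier G" "b \<in> carrier G" using ab by (auto simp: cayley_adj_def)
  have "wdist u v \<le> 1"
  proof -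
    have "u \<in> {a, b}" "v \<in> {a, b}" using ab u v by auto
    then show ?thesis using c cayley_adj_wdist[OF ab(1)] sym[OF c] zero_iff[of a a] zero_iff[of b b] by auto
  qed
  moreover have "(\<Sum>x\<in>supp p \<union> supp q. \<bar>p x - q x\<bar>) \<le> (\<Sum>x\<in>supp p \<union> supp q. 1)"
    using cayley_graph_point(4,5)[OF p] cayley_graph_point(4,5)[OF q]
    by (intro sum_mono) (smt (verit))
  moreover have "card (supp p \<union> supp q) \<le> card {a, b}" by (rule card_mono[OF _ ab(2)]) simp
  moreover have "card {a, b} \<le> 2" by (simp add: card_insert_if)
  moreover have "0 \<le> (\<Sum>x\<in>supp p \<union> supp q. \<bar>p x - q x\<bar>)" by (simp add: sum_nonneg)
  moreover have "cayley_dist G S p q = (\<Sum>x\<in>supp p \<union> supp q. \<bar>p x - q x\<bar>) / 2"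
    using True by (simp add: cayley_dist_def)
  ultimately show ?thesis unfolding sum_constant by linarith
next
  case False
  define A where "A = {(1 - p a) + word_dist G S a b + (1 - q b) | a b. a \<in> supp p \<and> b \<in> supp q}"
  have "A = (\<lambda>(a, b). (1 - p a) + word_dist G S a b + (1 - q b)) ` (supp p \<times> supp q)"
    by (auto simp: A_def)
  then have A: "finite A" "A \<noteq> {}" using cayley_graph_point(1,2)[OF p] cayley_graph_point(1,2)[OF q] by auto
  have "cayley_dist G S p q = Min A" by (simp only: cayley_dist_def A_def False if_False)
  then have "cayley_dist G S p q \<in> A" using Min_in[OF A] by simp
  then obtain a b where ab: "a \<in> supp p" "b \<in> supp q"
    "cayley_dist G S p q = (1 - p a) + word_dist G S a b + (1 - q b)" by (auto simp: A_def)
  have X: "a \<in> carrier G" "b \<in> carrier G" "u \<in> carrier G" "v \<in> carrier G"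
    using ab u v cayley_graph_point(3)[OF p] cayley_graph_point(3)[OF q] by auto
  have n: "wdist a u \<le> 1" "wdist b v \<le> 1" "wdist u a \<le> 1" "wdist v b \<le> 1"
    using cayley_graph_point(6)[OF p] cayley_graph_point(6)[OF q] ab u v by auto
  have "wdist a b \<le> wdist u v + 2" "wdist u v \<le> wdist a b + 2"
    using tri[OF X(1,3,2)] tri[OF X(3,4,2)] tri[OF X(3,1,4)] tri[OF X(1,2,4)] n by linarith+
  moreover have "word_dist G S a b = real (wdist a b)" by (simp add: word_dist_def wdist_def)
  ultimately show ?thesis
    using ab(3) cayley_graph_point(4,5)[OF p, of a] cayley_graph_point(4,5)[OF q, of b] by linarith
qed

text \<open>Any end with nonzero coordinate, not necessarily the nearest one; the error in distances
  is bounded for every choice.\<close>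

definition near_vertex :: "('a \<Rightarrow> real) \<Rightarrow> 'a" where
  "near_vertex p = (SOME u. u \<in> supp p)"

lemma near_vertex:
  assumes "p \<in> cayley_graph G S"
  shows "near_vertex p \<in> supp p" "near_vertex p \<in> carrier G"
proof -
  show "near_vertex p \<in> supp p"
    unfolding near_vertex_def using cayley_graph_point(1)[OF assms] by (auto intro: someI)
  then show "near_vertex p \<in> carrier G" using cayley_graph_point(3)[OF assms] by auto
qed

lemma near_vertex_vertex [simp]: "near_vertex (vertex u) = u"
  by (simp add: near_vertex_def)

section \<open>Transfer between discrete and continuous quasigeodesics\<close>

lemma vertex_in_cayley_graph: "u \<in> carrier G \<Longrightarrow> vertex u \<in> cayley_graph G S"
  by (simp add: cayley_graph_def)

lemma cayley_dist_near_vertex: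
  assumes "p \<in> cayley_graph G S" "q \<in> cayley_graph G S"
  shows "cayley_dist G S p q \<le> real (wdist (near_vertex p) (near_vertex q)) + 4"
    "real (wdist (near_vertex p) (near_vertex q)) \<le> cayley_dist G S p q + 4"
  using cayley_dist_wdist[OF assms near_vertex(1)[OF assms(1)] near_vertex(1)[OF assms(2)]] by linarith+

text \<open>Quasi-isometric embeddings need not be continuous, so a step function will do. Rounding
  shifts the parameter distance by at most 1, and passing from \<open>wdist\<close> to
  \<open>cayley_dist\<close> costs 4; both errors are absorbed in \<open>K * 2 + 8\<close>.\<close>

lemma quasigeod_imp_quasigeodesic:
  assumes q: "quasigeod (carrier G) wdist K n q" and K: "1 \<le> K"
  shows "quasigeodesic_between (real (K * 2 + 8)) 0 (real n) (cayley_graph G S) (cayley_dist G S)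
    (\<lambda>r. vertex (q (nat \<lfloor>r\<rfloor>))) (vertex (q 0)) (vertex (q n))"
proof -
  have qG: "q i \<in> carrier G" if "i \<le> n" for i using q that by (auto simp: quasigeod_def)
  let ?k = "real (K * 2 + 8)"
  have fl: "nat \<lfloor>r\<rfloor> \<le> n" if "r \<in> {0..real n}" for r using that by (simp add: floor_le_iff nat_le_iff)
  have main: "1 / ?k * dist a b - ?k \<le> cayley_dist G S (vertex (q (nat \<lfloor>a\<rfloor>))) (vertex (q (nat \<lfloor>b\<rfloor>))) \<and>
     cayley_dist G S (vertex (q (nat \<lfloor>a\<rfloor>))) (vertex (q (nat \<lfloor>b\<rfloor>))) \<le> ?k * dist a b + ?k"
    if ab: "a \<in> {0..real n}" "b \<in> {0..real n}" for a b
  proof -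
    define i j where "i = nat \<lfloor>a\<rfloor>" and "j = nat \<lfloor>b\<rfloor>"
    have ij: "i \<le> n" "j \<le> n" using fl ab by (auto simp: i_def j_def)
    have fa: "real i \<le> a" "a \<le> real i + 1" "real j \<le> b" "b \<le> real j + 1"
      using ab by (auto simp: i_def j_def)
    define d where "d = real (wdist (q i) (q j))"
    have bounds: "\<bar>real i - real j\<bar> \<le> K * d + K \<and> d \<le> K * \<bar>real i - real j\<bar> + K"
    proof (cases "i \<le> j")
      case True
      then have "j - i \<le> K * wdist (q i) (q j) + K" "wdist (q i) (q j) \<le> K * (j - i) + K"
        using q ij by (auto simp: quasigeod_def)
      then have "real (j - i) \<le> real (K * wdist (q i) (q j) + K)" "d \<le> real (K * (j - i) + K)"
        unfolding d_def of_nat_le_iff by auto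
      then show ?thesis using True by (simp add: d_def of_nat_diff)
    next
      case False
      then have "i - j \<le> K * wdist (q j) (q i) + K" "wdist (q j) (q i) \<le> K * (i - j) + K"
        using q ij by (auto simp: quasigeod_def)
      then have "real (i - j) \<le> real (K * wdist (q i) (q j) + K)" "d \<le> real (K * (i - j) + K)"
        unfolding d_def of_nat_le_iff using sym[OF qG[OF ij(1)] qG[OF ij(2)]] by auto
      then show ?thesis using False by (simp add: d_def of_nat_diff)
    qed
    have cd: "\<bar>cayley_dist G S (vertex (q i)) (vertex (q j)) - d\<bar> \<le> 4"
      unfolding d_def using cayley_dist_wdist[OF vertex_in_cayley_graph vertex_in_cayley_graph] qG ij by simp
    have dab: "dist a b \<le> \<bar>real i - real j\<bar> + 1" "\<bar>real i - real j\<bar> \<le> dist a b + 1"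
      using fa by (auto simp: dist_real_def)
    have "d \<le> K * \<bar>real i - real j\<bar> + K" using bounds by blast
    also have "\<dots> \<le> K * (dist a b + 1) + K" by (intro add_right_mono mult_left_mono dab) simp
    finally have up: "d \<le> K * dist a b + 2 * K" by (simp add: algebra_simps)
    have "K * dist a b \<le> ?k * dist a b" by (intro mult_right_mono) auto
    then have 1: "cayley_dist G S (vertex (q i)) (vertex (q j)) \<le> ?k * dist a b + ?k"
      using up cd K by simp
    have "dist a b \<le> K * d + K + 1" using dab bounds by linarith
    also have "\<dots> \<le> K * (d + 2)" using K by (simp add: algebra_simps)
    also have "\<dots> \<le> ?k * (d + 2)" by (intro mult_right_mono) (auto simp: d_def)
    finally have "1 / ?k * dist a b \<le> d + 2" by (simp add: field_simps)
    then have 2: "1 / ?k * dist a b - ?k \<le> cayley_dist G S (vertex (q i)) (vertex (q j))"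
      using cd by simp
    show ?thesis using 1 2 by (simp only: i_def j_def)
  qed
  have "qi_embedding ?k ?k {0..real n} dist (cayley_graph G S) (cayley_dist G S) (\<lambda>r. vertex (q (nat \<lfloor>r\<rfloor>)))"
    unfolding qi_embedding_def
  proof (intro conjI)
    show "(\<lambda>r. vertex (q (nat \<lfloor>r\<rfloor>))) \<in> {0..real n} \<rightarrow> cayley_graph G S"
      using fl qG vertex_in_cayley_graph by blast
  qed (use main in \<open>simp_all\<close>)
  then show ?thesis
    by (simp add: quasigeodesic_between_def quasigeodesic_def is_interval_cc)
qed

text \<open>The last index is clamped to \<open>t\<close>, as \<open>t - s\<close> need not be an integer.\<close>

lemma quasigeodesic_imp_quasigeod:
  assumes \<gamma>: "quasigeodesic_between \<kappa> s t (cayley_graph G S) (cayley_dist G S) \<gamma> (vertex a) (vertex b)"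
    and K: "\<kappa> * \<kappa> + 6 * \<kappa> + 5 \<le> real K"
  obtains n q where "quasigeod (carrier G) wdist K n q" "q 0 = a" "q n = b"
    "\<forall>j\<le>n. \<exists>r\<in>{s..t}. near_vertex (\<gamma> r) = q j"
    "\<forall>r\<in>{s..t}. \<exists>j\<le>n. wdist (near_vertex (\<gamma> r)) (q j) \<le> K"
proof -
  have st: "s \<le> t" and ends: "\<gamma> s = vertex a" "\<gamma> t = vertex b" and \<kappa>: "1 \<le> \<kappa>"
    and \<gamma>c: "\<And>r. r \<in> {s..t} \<Longrightarrow> \<gamma> r \<in> cayley_graph G S"
    and qi: "\<And>x y. x \<in> {s..t} \<Longrightarrow> y \<in> {s..t} \<Longrightarrow>
      1 / \<kappa> * dist x y - \<kappa> \<le> cayley_dist G S (\<gamma> x) (\<gamma> y) \<and> cayley_dist G S (\<gamma> x) (\<gamma> y) \<le> \<kappa> * dist x y + \<kappa>"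
    using \<gamma> unfolding quasigeodesic_between_def quasigeodesic_def qi_embedding_def by auto
  define n where "n = nat \<lceil>t - s\<rceil>"
  define \<tau> where "\<tau> = (\<lambda>i::nat. min (s + real i) t)"
  define q where "q = (\<lambda>i. near_vertex (\<gamma> (\<tau> i)))"
  have \<tau>: "\<tau> i \<in> {s..t}" for i using st by (auto simp: \<tau>_def)
  have n: "t - s \<le> real n" "real n < t - s + 1"
    using st by (auto simp: n_def) linarith+
  \<comment> \<open>Clearing the denominator multiplies the additive errors \<open>\<kappa>\<close>
    and 4 by \<open>\<kappa>\<close>; hence the quadratic term in the bound on
    \<open>K\<close>.\<close>
  have low: "dist x y \<le> \<kappa> * real (wdist (near_vertex (\<gamma> x)) (near_vertex (\<gamma> y))) + 4 * \<kappa> + \<kappa> * \<kappa>"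
    if "x \<in> {s..t}" "y \<in> {s..t}" for x y
  proof -
    have "1 / \<kappa> * dist x y \<le> real (wdist (near_vertex (\<gamma> x)) (near_vertex (\<gamma> y))) + 4 + \<kappa>"
      using qi[OF that] cayley_dist_near_vertex(1)[OF \<gamma>c \<gamma>c, OF that] by linarith
    then have "dist x y \<le> \<kappa> * (real (wdist (near_vertex (\<gamma> x)) (near_vertex (\<gamma> y))) + 4 + \<kappa>)"
      using \<kappa> by (simp add: field_simps)
    then show ?thesis by (simp add: algebra_simps)
  qed
  have upp: "real (wdist (near_vertex (\<gamma> x)) (near_vertex (\<gamma> y))) \<le> \<kappa> * dist x y + \<kappa> + 4"
    if "x \<in> {s..t}" "y \<in> {s..t}" for x y
    using qi[OF that] cayley_dist_near_vertex(2)[OF \<gamma>c \<gamma>c, OF that] by linarith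
  have \<kappa>K: "\<kappa> \<le> real K" using K \<kappa> zero_le_square[of \<kappa>] by linarith
  have "quasigeod (carrier G) wdist K n q"
    unfolding quasigeod_def
  proof (intro conjI allI impI)
    show "q i \<in> carrier G" for i using near_vertex(2)[OF \<gamma>c[OF \<tau>]] by (simp add: q_def)
    fix i j :: nat assume ij: "i \<le> j" "j \<le> n"
    have ijr: "real i \<le> real j" "real j \<le> real n" using ij by simp_all
    \<comment> \<open>Clamping shortens the last step by less than 1, whence the summand 1 in the
      second estimate.\<close>
    have d: "dist (\<tau> i) (\<tau> j) \<le> real (j - i)" "real (j - i) \<le> dist (\<tau> i) (\<tau> j) + 1"
      using ijr n ij by (auto simp: dist_real_def \<tau>_def min_def of_nat_diff)
    have "real (j - i) \<le> \<kappa> * real (wdist (q i) (q j)) + 4 * \<kappa> + \<kappa> * \<kappa> + 1"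
      using low[OF \<tau> \<tau>, of i j] d by (simp add: q_def)
    also have "\<dots> \<le> real K * real (wdist (q i) (q j)) + real K"
      using mult_right_mono[OF \<kappa>K, of "real (wdist (q i) (q j))"] K \<kappa> by simp
    finally have "real (j - i) \<le> real (K * wdist (q i) (q j) + K)" by simp
    then show "j - i \<le> K * wdist (q i) (q j) + K" unfolding of_nat_le_iff .
    have "real (wdist (q i) (q j)) \<le> \<kappa> * dist (\<tau> i) (\<tau> j) + \<kappa> + 4"
      using upp[OF \<tau> \<tau>] by (simp add: q_def)
    also have "\<dots> \<le> real K * real (j - i) + real K"
    proof -
      have "\<kappa> * dist (\<tau> i) (\<tau> j) \<le> real K * real (j - i)" using mult_mono[OF \<kappa>K d(1)] by simp
      then show ?thesis using K \<kappa> zero_le_square[of \<kappa>] by linarith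
    qed
    finally have "real (wdist (q i) (q j)) \<le> real (K * (j - i) + K)" by simp
    then show "wdist (q i) (q j) \<le> K * (j - i) + K" unfolding of_nat_le_iff .
  qed
  moreover have "\<tau> 0 = s" "\<tau> n = t" using st n by (simp_all add: \<tau>_def)
  then have "q 0 = a" "q n = b" using ends by (simp_all add: q_def)
  moreover have "\<exists>r\<in>{s..t}. near_vertex (\<gamma> r) = q j" for j using \<tau> by (auto simp: q_def)
  moreover have "\<exists>j\<le>n. wdist (near_vertex (\<gamma> r)) (q j) \<le> K" if r: "r \<in> {s..t}" for r
  proof -
    \<comment> \<open>The next sample after \<open>r\<close> is at parameter distance at most 1, so
      the vertices differ by at most \<open>2 * \<kappa> + 4\<close>.\<close>
    define j where "j = nat \<lceil>r - s\<rceil>"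
    have "real j < r - s + 1" "r - s \<le> real j" using r by (auto simp: j_def) linarith+
    then have "dist r (\<tau> j) \<le> 1" using r by (auto simp: \<tau>_def dist_real_def min_def)
    then have "\<kappa> * dist r (\<tau> j) \<le> \<kappa>" using \<kappa> by (simp add: mult_left_le)
    then have "real (wdist (near_vertex (\<gamma> r)) (q j)) \<le> real K"
      using upp[OF r \<tau>, of j] K \<kappa> zero_le_square[of \<kappa>] unfolding q_def by linarith
    moreover have "j \<le> n" using r unfolding j_def n_def by (intro nat_mono ceiling_mono) simp
    ultimately show ?thesis by auto
  qed
  ultimately show ?thesis using that by blast
qed

lemma hausdorff_imp_morse:
  assumes close: "\<forall>\<kappa>>1. \<exists>D>0. \<forall>a\<in>H. \<forall>b\<in>H. \<forall>s t s' t' \<gamma> \<gamma>'.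
           quasigeodesic_between \<kappa> s t (cayley_graph G S) (cayley_dist G S) \<gamma> (vertex a) (vertex b) \<longrightarrow>
           quasigeodesic_between \<kappa> s' t' (cayley_graph G S) (cayley_dist G S) \<gamma>' (vertex a) (vertex b) \<longrightarrow>
           hausdorff_close (cayley_dist G S) D (\<gamma> ` {s..t}) (\<gamma>' ` {s'..t'})"
  shows "morse H (carrier G) wdist"
  unfolding morse_def
proof
  fix K0 :: nat
  \<comment> \<open>The successor makes the constant positive, as the passage to step functions
    requires.\<close>
  define K where "K = Suc K0"
  have weaken: "quasigeod (carrier G) wdist K n q" if "quasigeod (carrier G) wdist K0 n q" for n q
    using that by (rule quasigeod_mono) (simp add: K_def)
  have "1 < real (K * 2 + 8)" by simp
  with close obtain D where D: "\<And>a b s t s' t' \<gamma> \<gamma>'. a \<in> H \<Longrightarrow> b \<in> H \<Longrightarrow>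
      quasigeodesic_between (real (K * 2 + 8)) s t (cayley_graph G S) (cayley_dist G S) \<gamma> (vertex a) (vertex b) \<Longrightarrow>
      quasigeodesic_between (real (K * 2 + 8)) s' t' (cayley_graph G S) (cayley_dist G S) \<gamma>' (vertex a) (vertex b) \<Longrightarrow>
      hausdorff_close (cayley_dist G S) D (\<gamma> ` {s..t}) (\<gamma>' ` {s'..t'})" by meson
  show "\<exists>D. \<forall>n q n' q'. quasigeod (carrier G) wdist K0 n q \<longrightarrow> quasigeod (carrier G) wdist K0 n' q' \<longrightarrow>
     q 0 \<in> H \<longrightarrow> q n \<in> H \<longrightarrow> q' 0 = q 0 \<longrightarrow> q' n' = q n \<longrightarrow> (\<forall>i\<le>n. \<exists>j\<le>n'. wdist (q i) (q' j) \<le> D)"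
  proof (rule exI[of _ "nat \<lceil>D + 4\<rceil>"], intro allI impI)
    fix n q n' q' i
    assume q: "quasigeod (carrier G) wdist K0 n q" and q': "quasigeod (carrier G) wdist K0 n' q'"
      and "q 0 \<in> H" "q n \<in> H" "q' 0 = q 0" "q' n' = q n" and i: "i \<le> n"
    then have "hausdorff_close (cayley_dist G S) D
       ((\<lambda>r. vertex (q (nat \<lfloor>r\<rfloor>))) ` {0..real n}) ((\<lambda>r. vertex (q' (nat \<lfloor>r\<rfloor>))) ` {0..real n'})"
      using D[of "q 0" "q n"] quasigeod_imp_quasigeodesic[OF weaken[OF q]] quasigeod_imp_quasigeodesic[OF weaken[OF q']]
      by (simp add: K_def)
    moreover have "vertex (q i) \<in> (\<lambda>r. vertex (q (nat \<lfloor>r\<rfloor>))) ` {0..real n}"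
      using i by (intro image_eqI[of _ _ "real i"]) auto
    ultimately obtain y where "y \<in> (\<lambda>r. vertex (q' (nat \<lfloor>r\<rfloor>))) ` {0..real n'}"
      "cayley_dist G S (vertex (q i)) y \<le> D"
      unfolding hausdorff_close_def in_nbhd_def by meson
    then obtain r where r: "0 \<le> r" "r \<le> real n'"
      "cayley_dist G S (vertex (q i)) (vertex (q' (nat \<lfloor>r\<rfloor>))) \<le> D"
      by auto
    have j: "nat \<lfloor>r\<rfloor> \<le> n'" using r by (simp add: floor_le_iff nat_le_iff)
    have "q i \<in> carrier G" "q' (nat \<lfloor>r\<rfloor>) \<in> carrier G" using q q' i j by (auto simp: quasigeod_def)
    from cayley_dist_near_vertex(2)[OF this[THEN vertex_in_cayley_graph]]
    have "real (wdist (q i) (q' (nat \<lfloor>r\<rfloor>))) \<le> D + 4" using r by simp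
    then have "wdist (q i) (q' (nat \<lfloor>r\<rfloor>)) \<le> nat \<lceil>D + 4\<rceil>" by linarith
    then show "\<exists>j\<le>n'. wdist (q i) (q' j) \<le> nat \<lceil>D + 4\<rceil>" using j by blast
  qed
qed

lemma morse_imp_hausdorff:
  assumes morse: "morse H (carrier G) wdist" and \<kappa>: "1 < \<kappa>"
  shows "\<exists>D>0. \<forall>a\<in>H. \<forall>b\<in>H. \<forall>s t s' t' \<gamma> \<gamma>'.
           quasigeodesic_between \<kappa> s t (cayley_graph G S) (cayley_dist G S) \<gamma> (vertex a) (vertex b) \<longrightarrow>
           quasigeodesic_between \<kappa> s' t' (cayley_graph G S) (cayley_dist G S) \<gamma>' (vertex a) (vertex b) \<longrightarrow>
           hausdorff_close (cayley_dist G S) D (\<gamma> ` {s..t}) (\<gamma>' ` {s'..t'})"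
proof -
  define K where "K = nat \<lceil>\<kappa> * \<kappa> + 6 * \<kappa> + 5\<rceil>"
  have K: "\<kappa> * \<kappa> + 6 * \<kappa> + 5 \<le> real K" unfolding K_def by (rule real_nat_ceiling_ge)
  obtain D where D: "\<And>n q n' q' i. quasigeod (carrier G) wdist K n q \<Longrightarrow> quasigeod (carrier G) wdist K n' q' \<Longrightarrow>
     q 0 \<in> H \<Longrightarrow> q n \<in> H \<Longrightarrow> q' 0 = q 0 \<Longrightarrow> q' n' = q n \<Longrightarrow> i \<le> n \<Longrightarrow> \<exists>j\<le>n'. wdist (q i) (q' j) \<le> D"
    using morse unfolding morse_def by meson
  \<comment> \<open>\<open>K\<close> leads from a point of \<open>\<gamma>\<close> to a sample,
    \<open>D\<close> to a sample of the other path, which is the \<open>near_vertex\<close> of one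
    of its points, and 4 returns to \<open>cayley_dist\<close>.\<close>
  define D' where "D' = real (K + D) + 4"
  have nbhd: "\<exists>y\<in>\<gamma>' ` {s'..t'}. cayley_dist G S (\<gamma> r) y \<le> D' \<and> cayley_dist G S y (\<gamma> r) \<le> D'"
    if ab: "a \<in> H" "b \<in> H"
      and \<gamma>: "quasigeodesic_between \<kappa> s t (cayley_graph G S) (cayley_dist G S) \<gamma> (vertex a) (vertex b)"
      and \<gamma>': "quasigeodesic_between \<kappa> s' t' (cayley_graph G S) (cayley_dist G S) \<gamma>' (vertex a) (vertex b)"
      and r: "r \<in> {s..t}"
    for a b s t s' t' \<gamma> \<gamma>' r
  proof -
    obtain n q where q: "quasigeod (carrier G) wdist K n q" "q 0 = a" "q n = b"
      "\<forall>j\<le>n. \<exists>r\<in>{s..t}. near_vertex (\<gamma> r) = q j"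
      "\<forall>r\<in>{s..t}. \<exists>j\<le>n. wdist (near_vertex (\<gamma> r)) (q j) \<le> K"
      by (rule quasigeodesic_imp_quasigeod[OF \<gamma> K])
    obtain n' q' where q': "quasigeod (carrier G) wdist K n' q'" "q' 0 = a" "q' n' = b"
      "\<forall>j\<le>n'. \<exists>r\<in>{s'..t'}. near_vertex (\<gamma>' r) = q' j"
      "\<forall>r\<in>{s'..t'}. \<exists>j\<le>n'. wdist (near_vertex (\<gamma>' r)) (q' j) \<le> K"
      by (rule quasigeodesic_imp_quasigeod[OF \<gamma>' K])
    obtain i where i: "i \<le> n" "wdist (near_vertex (\<gamma> r)) (q i) \<le> K" using q(5) r by blast
    obtain j where j: "j \<le> n'" "wdist (q i) (q' j) \<le> D" using D[OF q(1) q'(1), of i] q(2,3) q'(2,3) ab i(1) by auto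
    obtain r' where r': "r' \<in> {s'..t'}" "near_vertex (\<gamma>' r') = q' j" using q'(4) j(1) by blast
    have c: "\<gamma> r \<in> cayley_graph G S" "\<gamma>' r' \<in> cayley_graph G S"
      using \<gamma> \<gamma>' r r' unfolding quasigeodesic_between_def quasigeodesic_def qi_embedding_def Pi_iff by simp_all
    have X: "near_vertex (\<gamma> r) \<in> carrier G" "q i \<in> carrier G" "q' j \<in> carrier G"
      using near_vertex(2)[OF c(1)] q q' i j by (auto simp: quasigeod_def)
    have "wdist (near_vertex (\<gamma> r)) (near_vertex (\<gamma>' r')) \<le> K + D"
      using tri[OF X] i j r' by simp
    then have "real (wdist (near_vertex (\<gamma> r)) (near_vertex (\<gamma>' r'))) \<le> real (K + D)" by simp
    moreover have "wdist (near_vertex (\<gamma>' r')) (near_vertex (\<gamma> r)) = wdist (near_vertex (\<gamma> r)) (near_vertex (\<gamma>' r'))"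
      using sym X(1,3) r' by simp
    ultimately show ?thesis
      using cayley_dist_near_vertex(1)[OF c] cayley_dist_near_vertex(1)[OF c(2,1)] r'(1)
      by (intro bexI[of _ "\<gamma>' r'"]) (auto simp: D'_def)
  qed
  show ?thesis
  proof (rule exI[of _ D'], intro conjI ballI allI impI)
    show "0 < D'" by (simp add: D'_def)
    fix a b s t s' t' \<gamma> \<gamma>'
    assume ab: "a \<in> H" "b \<in> H"
      and \<gamma>: "quasigeodesic_between \<kappa> s t (cayley_graph G S) (cayley_dist G S) \<gamma> (vertex a) (vertex b)"
      and \<gamma>': "quasigeodesic_between \<kappa> s' t' (cayley_graph G S) (cayley_dist G S) \<gamma>' (vertex a) (vertex b)"
    show "hausdorff_close (cayley_dist G S) D' (\<gamma> ` {s..t}) (\<gamma>' ` {s'..t'})"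
      unfolding hausdorff_close_def in_nbhd_def
      using nbhd[OF ab \<gamma> \<gamma>'] nbhd[OF ab \<gamma>' \<gamma>] by blast
  qed
qed

end

theorem theorem1p6:
  fixes G :: "('a, 'b) monoid_scheme" and H L :: "'a set"
  assumes "group G" and "finitely_generated G"
    and "subgroup L G" and "finitely_generated (G\<lparr>carrier := L\<rparr>)"
    and "subgroup H (G\<lparr>carrier := L\<rparr>)" and "finitely_generated (G\<lparr>carrier := H\<rparr>)"
    and "stable G H"
  shows "stable (G\<lparr>carrier := L\<rparr>) H"
proof -
  obtain S T \<kappa> c where HG: "subgroup H G" and S: "finite_generating_set G S"
    and T: "finite_generating_set (G\<lparr>carrier := H\<rparr>) T"
    and qi: "qi_embedding \<kappa> c H (word_dist (G\<lparr>carrier := H\<rparr>) T) (carrier G) (word_dist G S) (\<lambda>h. h)"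
    and close: "\<forall>\<kappa>>1. \<exists>D>0. \<forall>a\<in>H. \<forall>b\<in>H. \<forall>s t s' t' \<gamma> \<gamma>'.
           quasigeodesic_between \<kappa> s t (cayley_graph G S) (cayley_dist G S) \<gamma> (vertex a) (vertex b) \<longrightarrow>
           quasigeodesic_between \<kappa> s' t' (cayley_graph G S) (cayley_dist G S) \<gamma>' (vertex a) (vertex b) \<longrightarrow>
           hausdorff_close (cayley_dist G S) D (\<gamma> ` {s..t}) (\<gamma>' ` {s'..t'})"
    using assms(7) unfolding stable_def by blast
  \<comment> \<open>\<open>S\<close> and \<open>T\<close> are those provided by stability in
    \<open>G\<close>, and \<open>T\<close> is kept for \<open>H\<close> in \<open>L\<close>;
    \<open>U\<close> may be any finite generating set of \<open>L\<close>.\<close>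
  obtain U where U: "finite_generating_set (G\<lparr>carrier := L\<rparr>) U"
    using assms(4) unfolding finitely_generated_def by blast
  have T': "finite_generating_set (G\<lparr>carrier := L\<rparr>\<lparr>carrier := H\<rparr>) T" using T by simp
  interpret gG: fg_group G S using assms(1) S by (simp add: fg_group_def fg_group_axioms_def)
  interpret gL: fg_group "G\<lparr>carrier := L\<rparr>" U by (rule fg_group_subgroup[OF assms(1,3) U])
  interpret gH: fg_group "G\<lparr>carrier := H\<rparr>" T by (rule fg_group_subgroup[OF assms(1) HG T])
  have HL: "H \<subseteq> L" using subgroup.subset[OF assms(5)] by simp
  have LG: "L \<subseteq> carrier G" by (rule subgroup.subset[OF assms(3)])
  obtain B where B: "1 \<le> B" "\<And>x y. x \<in> H \<Longrightarrow> y \<in> H \<Longrightarrow> gL.wdist x y \<le> B * gH.wdist x y"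
    using gL.subgroup_wdist_upper[OF assms(5) T'] by auto
  obtain M where M: "1 \<le> M" "\<And>x y. x \<in> L \<Longrightarrow> y \<in> L \<Longrightarrow> gG.wdist x y \<le> M * gL.wdist x y"
    using gG.subgroup_wdist_upper[OF assms(3) U] by auto
  have wd: "word_dist (G\<lparr>carrier := H\<rparr>) T x y = real (gH.wdist x y)"
      "word_dist (G\<lparr>carrier := L\<rparr>) U x y = real (gL.wdist x y)"
      "word_dist G S x y = real (gG.wdist x y)" for x y
    by (simp_all add: word_dist_def gH.wdist_def gL.wdist_def gG.wdist_def)
  have \<kappa>: "1 \<le> \<kappa>" "0 \<le> c" using qi by (auto simp: qi_embedding_def)
  \<comment> \<open>Distinct points have \<open>dG\<close>-distance at least 1, so the additive term
    \<open>\<kappa> * c\<close> is absorbed in the factor.\<close>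
  define A where "A = nat \<lceil>\<kappa> + \<kappa> * c\<rceil>"
  have A: "\<kappa> + \<kappa> * c \<le> real A" by (simp add: A_def real_nat_ceiling_ge)
  have "1 \<le> \<kappa> + \<kappa> * c" using \<kappa> mult_nonneg_nonneg[of \<kappa> c] by linarith
  then have A1: "1 \<le> A" using A by linarith
  have dH_le: "gH.wdist x y \<le> A * gG.wdist x y" if xy: "x \<in> H" "y \<in> H" for x y
  proof (cases "gG.wdist x y = 0")
    case True
    then have "x = y" using gG.zero_iff[of x y] xy HL LG by auto
    then show ?thesis using gH.zero_iff[of x y] xy by simp
  next
    case False
    then have 1: "1 \<le> real (gG.wdist x y)" by simp
    have "1 / \<kappa> * real (gH.wdist x y) \<le> real (gG.wdist x y) + c"
      using qi xy unfolding qi_embedding_def wd by force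
    then have "real (gH.wdist x y) \<le> \<kappa> * real (gG.wdist x y) + \<kappa> * c"
      using \<kappa> by (simp add: field_simps)
    also have "\<dots> \<le> \<kappa> * real (gG.wdist x y) + \<kappa> * c * real (gG.wdist x y)"
      using mult_left_mono[OF 1, of "\<kappa> * c"] \<kappa> by simp
    also have "\<dots> = (\<kappa> + \<kappa> * c) * real (gG.wdist x y)" by (simp add: algebra_simps)
    also have "\<dots> \<le> real A * real (gG.wdist x y)" by (intro mult_right_mono A) simp
    finally have "real (gH.wdist x y) \<le> real (A * gG.wdist x y)" by simp
    then show ?thesis unfolding of_nat_le_iff .
  qed
  have mH: "geodesic_nat_metric H gH.wdist" using gH.geodesic_nat_metric_axioms by simp
  have mL: "geodesic_nat_metric L gL.wdist" using gL.geodesic_nat_metric_axioms by simp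
  interpret subgroup_metrics H L "carrier G" gH.wdist gL.wdist gG.wdist A B M
  proof (intro subgroup_metrics.intro subgroup_metrics_axioms.intro mH mL)
    show "geodesic_nat_metric (carrier G) gG.wdist" by (rule gG.geodesic_nat_metric_axioms)
    show "morse H (carrier G) gG.wdist"
      by (rule gG.hausdorff_imp_morse[OF close])
    show "\<exists>D'. \<forall>x\<in>L. \<forall>y\<in>L. gG.wdist x y \<le> D \<longrightarrow> gL.wdist x y \<le> D'" for D
      by (rule gG.subgroup_wdist_proper[OF assms(3) U])
  qed (fact HL LG A1 B M dH_le)+
  \<comment> \<open>The sum serves as one constant for both inequalities: \<open>A * M\<close> for
    the lower and \<open>B\<close> for the upper.\<close>
  have "1 \<le> A * M + B" using B(1) by simp
  then have C: "1 \<le> real (A * M + B)" by (metis of_nat_1 of_nat_mono)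
  have "qi_embedding (real (A * M + B)) 0 H (word_dist (G\<lparr>carrier := H\<rparr>) T) L (word_dist (G\<lparr>carrier := L\<rparr>) U) (\<lambda>h. h)"
    unfolding qi_embedding_def wd
  proof (intro conjI ballI)
    show "1 \<le> real (A * M + B)" by (rule C)
    show "(\<lambda>h. h) \<in> H \<rightarrow> L" using HL by auto
    fix x y assume xy: "x \<in> H" "y \<in> H"
    have "gH.wdist x y \<le> (A * M + B) * gL.wdist x y"
      using dH_le_dL[OF xy] by (simp add: algebra_simps)
    then have "real (gH.wdist x y) \<le> real ((A * M + B) * gL.wdist x y)" unfolding of_nat_le_iff .
    moreover have "0 < real (A * M + B)" using C by linarith
    ultimately show "1 / real (A * M + B) * real (gH.wdist x y) - 0 \<le> real (gL.wdist x y)"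
      by (simp add: field_simps)
    have "gL.wdist x y \<le> (A * M + B) * gH.wdist x y" using B(2)[OF xy] by (simp add: algebra_simps)
    then have "real (gL.wdist x y) \<le> real ((A * M + B) * gH.wdist x y)" unfolding of_nat_le_iff .
    then show "real (gL.wdist x y) \<le> real (A * M + B) * real (gH.wdist x y) + 0" by simp
  qed simp
  moreover have "morse H (carrier (G\<lparr>carrier := L\<rparr>)) gL.wdist" using morse_L by simp
  ultimately show ?thesis
    unfolding stable_def
    using gL.is_group assms(5) U T' gL.morse_imp_hausdorff[of H] HL
    by (intro conjI exI[of _ U] exI[of _ T]) auto
qed

end
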